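(* Let $k\ge 4$ and $s$ be integers with $2\le s\le k+1$. Then, for positive integers $n$, $$\sum_{m=1}^n r_{k,s}(m) = \frac{\Gamma \big( \frac{k+1}{k} \big)^s}{\Gamma\big( \frac{k+s}{k} \big)} n^{\frac{s}{k}} - \frac{s}{2}\cdot \frac{\Gamma \big( \frac{k+1}{k} \big)^{s-1}}{\Gamma\big( \frac{k+s-1}{k} \big)} n^{\frac{s-1}{k}} +O\Big(n^{\frac{(s-1)k-1}{k^2}} \Big),$$ or equivalently, for real $x>1$, $$\sum_{m\le x} r_{k,s}(m) = \frac{\Gamma \big( \frac{k+1}{k} \big)^s}{\Gamma\big( \frac{k+s}{k} \big)} x^{\frac{s}{k}} - \frac{s}{2}\cdot \frac{\Gamma \big( \frac{k+1}{k} \big)^{s-1}}{\Gamma\big( \frac{k+s-1}{k} \big)} x^{\frac{s-1}{k}} +O\Big(x^{\frac{(s-1)k-1}{k^2}} \Big).$$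
   Context: For integers $k,s\ge 2$ and a positive integer $n$, $r_{k,s}(n)$ denotes the number of ordered $s$-tuples $(x_1,\dots,x_s)$ of positive integers with $x_1^k+x_2^k+\cdots+x_s^k=n$. The sum $\sum_{m\le x}$ runs over positive integers $m\le x$. $\Gamma$ is the Euler gamma function. The implied constants in the $O$-terms may depend on $k$ and $s$ but not on $n$ or $x$. *)

theory Defs
  imports "HOL-Analysis.Analysis"
begin

definition rep_tuples :: "nat \<Rightarrow> nat \<Rightarrow> nat \<Rightarrow> nat list set" where
  "rep_tuples k s n =
     {xs. length xs = s \<and> (\<forall>x\<in>set xs. 0 < x) \<and> (\<Sum>x\<leftarrow>xs. x ^ k) = n}"

definition r :: "nat \<Rightarrow> nat \<Rightarrow> nat \<Rightarrow> nat" where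
  "r k s n = card (rep_tuples k s n)"

(* For k > 0 the set counted by r is finite, so its cardinality is the true count
   and not the default value 0 that card gives on infinite sets. *)
lemma finite_rep_tuples:
  assumes "0 < k"
  shows "finite (rep_tuples k s n)"
proof (rule finite_subset)
  show "rep_tuples k s n \<subseteq> {xs. set xs \<subseteq> {..n} \<and> length xs = s}"
  proof
    fix xs assume xs: "xs \<in> rep_tuples k s n"
    have "x \<le> n" if "x \<in> set xs" for x
    proof -
      have "x \<le> x ^ k"
        using assms by (cases "x = 0") (auto intro: self_le_power)
      also have "\<dots> \<le> (\<Sum>x\<leftarrow>xs. x ^ k)"
        using that by (intro member_le_sum_list) auto
      finally show ?thesis
        using xs by (simp add: rep_tuples_def)
    qed
    then show "xs \<in> {xs. set xs \<subseteq> {..n} \<and> length xs = s}"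
      using xs by (auto simp: rep_tuples_def)
  qed
  show "finite {xs. set xs \<subseteq> {..n} \<and> length xs = s}"
    by (rule finite_lists_length_eq) simp
qed

end

theory Submission
  imports Defs
begin

text \<open>
  Write \<open>X = x powr (1/k)\<close> and let \<open>N s x\<close> count the \<open>s\<close>-tuples of positive integers whose
  \<open>k\<close>-th powers sum to at most \<open>x\<close>. The proof is an induction on \<open>s\<close>, and nearly all of its
  weight lies in the base case \<open>s = 2\<close>.

  Removing one coordinate gives \<open>N (s + 1) x = (\<Sum>m\<le>X. N s (x - m ^ k))\<close>. Each of the at most
  \<open>X\<close> summands inherits an error of the order allowed for \<open>s\<close>, and \<open>X\<close> times that order is the
  order allowed for \<open>s + 1\<close>. The main terms turn into sums of \<open>(x - m ^ k) powr p\<close> with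
  \<open>0 < p \<le> 1\<close>; the bound \<open>s \<le> k + 1\<close> is what keeps \<open>p \<le> 1\<close>. Such a summand is concave and
  decreasing in \<open>m\<close>, so the trapezoid rule replaces the sum by an integral up to an error
  governed by its last values (\<open>sum_lame_powr\<close>). The integral is a Beta integral, which yields
  the quotients of Gamma values, and the endpoint contribution \<open>- (x powr p) / 2\<close> of the
  leading term raises the factor \<open>s/2\<close> of the second main term to \<open>(s + 1)/2\<close>
  (\<open>card_tuples_le_asymptotic_step\<close>).

  For \<open>s = 2\<close> the task is to count lattice points below the curve
  \<open>f t = (X ^ k - t ^ k) powr (1/k)\<close> with an error \<open>O(X powr (1 - 1/k))\<close>. By symmetry in the
  diagonal it is enough to count the points whose first coordinate is at most
  \<open>Y = X / 2 powr (1/k)\<close>, where the slope of the curve (in absolute value) stays in \<open>{0..1}\<close>.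
  Comparing the sum of \<open>\<lfloor>f n\<rfloor>\<close> with the area leaves the sum of the sawtooth function
  \<open>frac t - 1/2\<close> at the points \<open>f n\<close>, and this has to be \<open>O(X powr (1 - 1/k))\<close>
  (\<open>sum_sawtooth_bound\<close>).

  The sawtooth sum is cut into blocks of consecutive \<open>n\<close>. If the curve stays close to a line of
  slope \<open>a/q\<close> in lowest terms along a block of length \<open>q\<close>, then the values \<open>f n\<close> are almost
  equally spaced modulo 1, so the block contributes \<open>O(1)\<close>
  (\<open>sum_sawtooth_near_rational_line\<close>). The blocks depend on the slope:

  \<^item> For \<open>n \<le> X powr (1 - 1/k)\<close> the curve is so flat that it drops by at most 1; this part is
    bounded trivially and accounts for the error term.

  \<^item> While the slope is below about \<open>X powr (-1/3)\<close>, take \<open>a = 1\<close> and \<open>q\<close> close to the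
    reciprocal of the slope. The curve drops by about 1 along each block, so there are
    \<open>O(X powr (2/3))\<close> blocks, and the deviations from the lines telescope to the reciprocal of
    the initial slope, which is again \<open>O(X powr (1 - 1/k))\<close> (\<open>sum_sawtooth_small_slope\<close>).

  \<^item> For larger slopes, Dirichlet's theorem supplies \<open>a/q\<close> with \<open>q \<le> X powr (1/3)\<close>. Since the
    slope divided by \<open>t\<close> is increasing, the slope leaves the neighbourhood of each \<open>a/q\<close>
    quickly, and few blocks share the same fraction. Summing over all fractions gives
    \<open>X powr (2/3)\<close> times the square of a logarithm (\<open>sum_sawtooth_large_slope\<close>). As \<open>k \<ge> 4\<close>,
    this is at most of the order \<open>X powr (3/4)\<close>, hence of the order \<open>X powr (1 - 1/k)\<close>.
\<close>

section \<open>Sawtooth sums near a line of rational slope\<close>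

definition sawtooth :: "real \<Rightarrow> real" where "sawtooth t = frac t - 1/2"

lemma abs_sawtooth_le: "\<bar>sawtooth t\<bar> \<le> 1/2"
  using frac_ge_0[of t] frac_lt_1[of t] unfolding sawtooth_def abs_le_iff by linarith

text \<open>
  As \<open>a\<close> is invertible modulo \<open>q\<close>, the numbers \<open>a j\<close> run through all residues, and the
  points \<open>y + a j / q\<close> are equally spaced modulo 1. This is Hermite's identity
  \<open>(\<Sum>j<q. \<lfloor>y + j / q\<rfloor>) = \<lfloor>q y\<rfloor>\<close> written for the sawtooth function.
\<close>
lemma sum_sawtooth_arith_progression:
  fixes a :: int and q :: nat and y :: real
  assumes "coprime a (int q)" "0 < q"
  shows "(\<Sum>j<q. sawtooth (y + of_int a * real j / real q)) = sawtooth (real q * y)"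
proof -
  define N where "N = \<lfloor>real q * y\<rfloor>"
  \<comment> \<open>The residues \<open>h j\<close> are \<open>0, ..., q - 1\<close> in some order; they carry all the dependence on \<open>a\<close>.\<close>
  define h where "h j = (N + a * int j) mod int q" for j
  have fl: "\<lfloor>y + of_int a * real j / real q\<rfloor> = (N + a * int j) div int q" for j
  proof -
    have "y + of_int a * real j / real q = (real q * y + of_int (a * int j)) / real_of_int (int q)"
      using assms by (simp add: field_simps)
    also have "\<lfloor>\<dots>\<rfloor> = \<lfloor>real q * y + of_int (a * int j)\<rfloor> div int q"
      by (rule floor_divide_real_eq_div) simp
    also have "\<lfloor>real q * y + of_int (a * int j)\<rfloor> = N + a * int j"
      unfolding N_def by (rule floor_add_int[symmetric])
    finally show ?thesis .
  qed
  have inj: "inj_on h {..<q}"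
  proof (rule inj_onI)
    fix i j assume ij: "i \<in> {..<q}" "j \<in> {..<q}" "h i = h j"
    then have "int q dvd (N + a * int i) - (N + a * int j)"
      by (simp add: h_def mod_eq_dvd_iff)
    then have "int q dvd a * (int i - int j)" by (simp add: algebra_simps)
    then have "int q dvd int i - int j"
      using assms(1) by (simp add: coprime_dvd_mult_right_iff coprime_commute)
    then have "int i mod int q = int j mod int q" by (simp add: mod_eq_dvd_iff)
    then show "i = j" using ij by simp
  qed
  have "h ` {..<q} \<subseteq> int ` {..<q}"
  proof
    fix z assume "z \<in> h ` {..<q}"
    then have "0 \<le> z" "z < int q" using assms(2) by (auto simp: h_def)
    then show "z \<in> int ` {..<q}" by (intro image_eqI[of _ _ "nat z"]) auto
  qed
  moreover have "card (h ` {..<q}) = card (int ` {..<q})"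
    by (simp add: card_image inj)
  ultimately have im: "h ` {..<q} = int ` {..<q}" by (intro card_subset_eq) auto
  have "(\<Sum>j<q. h j) = (\<Sum>z\<in>h ` {..<q}. z)" by (simp add: sum.reindex inj)
  also have "\<dots> = (\<Sum>j<q. int j)" unfolding im by (simp add: sum.reindex)
  finally have "real_of_int (\<Sum>j<q. h j) = real_of_int (\<Sum>j<q. int j)" by simp
  then have hsum: "(\<Sum>j<q. real_of_int (h j)) = (\<Sum>j<q. real j)" by simp
  have "real q * sawtooth (y + of_int a * real j / real q)
      = real q * y - of_int N + of_int (h j) - real q / 2" for j
  proof -
    have "h j = (N + a * int j) - int q * ((N + a * int j) div int q)"
      unfolding h_def by (simp add: minus_mult_div_eq_mod)
    then have e: "real_of_int (h j) = of_int N + of_int a * real j - real q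
      * of_int ((N + a * int j) div int q)"
      by simp
    show ?thesis unfolding sawtooth_def frac_def fl e using assms(2) by (simp add: field_simps)
  qed
  then have "real q * (\<Sum>j<q. sawtooth (y + of_int a * real j / real q))
      = real q * (real q * y - of_int N) + (\<Sum>j<q. real j) - real q * real q / 2"
    by (simp add: sum_distrib_left sum.distrib sum_subtractf hsum)
  also have "(\<Sum>j<q. real j) = real q * (real q - 1) / 2"
    by (induction q) (auto simp: field_simps)
  finally have "real q * (\<Sum>j<q. sawtooth (y + of_int a * real j / real q)) = real q
    * (real q * y - of_int N - 1/2)"
    by (simp add: field_simps)
  then show ?thesis using assms(2) by (simp add: sawtooth_def frac_def N_def)
qed

text \<open>
  The sawtooth function jumps, so a perturbation by \<open>D\<close> cannot be treated termwise. Instead the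
  monotone floor of \<open>u j\<close> is squeezed between the floors on the two lines shifted by \<open>D\<close> and
  \<open>- D\<close>; on each of these lines the previous identity bounds the whole sum by \<open>1/2\<close>.
\<close>
lemma sum_sawtooth_near_rational_line:
  fixes a :: int and q :: nat and c D :: real
  assumes "coprime a (int q)" "0 < q"
    and near: "\<And>j. j < q \<Longrightarrow> \<bar>u j - (c - of_int a * real j / real q)\<bar> \<le> D"
  shows "\<bar>\<Sum>j<q. sawtooth (u j)\<bar> \<le> 1/2 + 2 * real q * D"
proof -
  have cop: "coprime (-a) (int q)" using assms(1) by simp
  define v where "v e j = c + e + of_int (-a) * real j / real q" for e :: real and j :: nat
  have bd: "\<bar>\<Sum>j<q. sawtooth (v e j)\<bar> \<le> 1/2" for e
    unfolding v_def sum_sawtooth_arith_progression[OF cop assms(2)] by (rule abs_sawtooth_le)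
  have lo: "sawtooth (v D j) - 2 * D \<le> sawtooth (u j)" and hi:
    "sawtooth (u j) \<le> sawtooth (v (-D) j) + 2 * D"
    if "j < q" for j
  proof -
    have d: "v (-D) j \<le> u j" "u j \<le> v D j" "v D j = v (-D) j + 2 * D"
      using near[OF that] by (auto simp: v_def abs_le_iff)
    then have "real_of_int \<lfloor>v (-D) j\<rfloor> \<le> of_int \<lfloor>u j\<rfloor>" "real_of_int \<lfloor>u j\<rfloor> \<le> of_int \<lfloor>v D j\<rfloor>"
      by (simp_all add: floor_mono)
    with d show "sawtooth (v D j) - 2 * D \<le> sawtooth (u j)"
      "sawtooth (u j) \<le> sawtooth (v (-D) j) + 2 * D"
      by (auto simp: sawtooth_def frac_def)
  qed
  have "(\<Sum>j<q. sawtooth (v D j) - 2 * D) \<le> (\<Sum>j<q. sawtooth (u j))" by (intro sum_mono lo) auto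
  moreover have "(\<Sum>j<q. sawtooth (u j)) \<le> (\<Sum>j<q. sawtooth (v (-D) j) + 2 * D)"
    by (intro sum_mono hi) auto
  ultimately show ?thesis using bd[of D] bd[of "-D"]
    by (simp add: sum.distrib sum_subtractf abs_le_iff) linarith
qed

section \<open>Cutting sums into blocks\<close>

text \<open>
  The blocks are chosen greedily from left to right, each with a length that depends on its
  starting point. A weight \<open>w\<close> that pays for every possible block takes the place of a
  description of the resulting partition; \<open>B\<close> pays for the last, incomplete block.
\<close>
lemma abs_sum_le_by_blocks:
  fixes g w :: "nat \<Rightarrow> real"
  assumes w: "\<And>n. m0 \<le> n \<Longrightarrow> n < m1 \<Longrightarrow> 0 \<le> w n" and "0 \<le> B"
    and step: "\<And>m. m0 \<le> m \<Longrightarrow> m < m1 \<Longrightarrow> \<bar>\<Sum>n=m..<m1. g n\<bar> \<le> B \<or>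
       (\<exists>q>0. m + q \<le> m1 \<and> \<bar>\<Sum>n=m..<m+q. g n\<bar> \<le> (\<Sum>n=m..<m+q. w n))"
  shows "\<bar>\<Sum>n=m0..<m1. g n\<bar> \<le> (\<Sum>n=m0..<m1. w n) + B"
proof -
  have "\<bar>\<Sum>n=m..<m1. g n\<bar> \<le> (\<Sum>n=m..<m1. w n) + B" if "m0 \<le> m" for m
    using that
  proof (induction "m1 - m" arbitrary: m rule: less_induct)
    case less
    have wpos: "0 \<le> (\<Sum>n=m..<m1. w n)" using less.prems by (intro sum_nonneg w) auto
    show ?case
    proof (cases "m < m1")
      case False then show ?thesis using \<open>0 \<le> B\<close> by simp
    next
      case True
      from step[OF less.prems True] show ?thesis
      proof (elim disjE exE conjE)
        assume "\<bar>\<Sum>n=m..<m1. g n\<bar> \<le> B" then show ?thesis using wpos by simp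
      next
        fix q assume q: "0 < q" "m + q \<le> m1" "\<bar>\<Sum>n=m..<m+q. g n\<bar> \<le> (\<Sum>n=m..<m+q. w n)"
        have IH: "\<bar>\<Sum>n=m+q..<m1. g n\<bar> \<le> (\<Sum>n=m+q..<m1. w n) + B"
          using q True less.prems by (intro less.hyps) auto
        have "(\<Sum>n=m..<m1. h n) = (\<Sum>n=m..<m+q. h n) + (\<Sum>n=m+q..<m1. h n)" for h :: "nat \<Rightarrow> real"
          using q by (simp add: sum.atLeastLessThan_concat)
        from this[of g] this[of w] show ?thesis using q IH by linarith
      qed
    qed
  qed
  then show ?thesis by simp
qed

lemma card_le_of_diff_bounded:
  fixes L :: real
  assumes "finite S" "0 \<le> L" and diff: "\<And>m n. m \<in> S \<Longrightarrow> n \<in> S \<Longrightarrow> m \<le> n \<Longrightarrow> real n - real m \<le> L"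
  shows "real (card S) \<le> L + 1"
proof (cases "S = {}")
  case False
  define m where "m = Min S"
  have mS: "m \<in> S" using False assms by (simp add: m_def)
  have "S \<subseteq> {m..m + nat \<lfloor>L\<rfloor>}"
  proof
    fix n assume n: "n \<in> S"
    then have "m \<le> n" using assms by (simp add: m_def)
    moreover have "real (n - m) \<le> L" using diff[OF mS n] \<open>m \<le> n\<close> by simp
    then have "n - m \<le> nat \<lfloor>L\<rfloor>" by (simp add: le_nat_floor)
    ultimately show "n \<in> {m..m + nat \<lfloor>L\<rfloor>}" by auto
  qed
  then have "card S \<le> card {m..m + nat \<lfloor>L\<rfloor>}" by (intro card_mono) auto
  also have "\<dots> = nat \<lfloor>L\<rfloor> + 1" by simp
  finally have "real (card S) \<le> real (nat \<lfloor>L\<rfloor>) + 1" by linarith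
  also have "real (nat \<lfloor>L\<rfloor>) \<le> L" using assms(2) by (rule of_nat_floor)
  finally show ?thesis by simp
qed (use assms in auto)

text \<open>
  Two harmonic sums occur below, with arguments up to about \<open>2 X powr (1/3)\<close>. The exponent
  \<open>1/8\<close> bounds their product by a multiple of \<open>X powr (1/12)\<close>, which is exactly the gap
  between \<open>2/3\<close> and \<open>3/4\<close>.
\<close>
lemma harm_le_powr:
  assumes "0 < n"
  shows "(harm n :: real) \<le> 9 * real n powr (1/8)"
proof -
  have "harm n \<le> 1 + ln (real n)"
    using assms
  proof (induction n rule: nat_induct_non_zero)
    case 1 then show ?case by (simp add: harm_def)
  next
    case (Suc n)
    have "inverse (real (Suc n)) \<le> ln (real (Suc n)) - ln (real n)"
    proof -
      have "- ln (real (Suc n) / real n) = ln (real n / real (Suc n))"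
        using Suc.hyps by (simp add: ln_div)
      also have "\<dots> \<le> real n / real (Suc n) - 1" using Suc.hyps by (intro ln_le_minus_one) auto
      also have "\<dots> = - inverse (real (Suc n))" by (simp add: field_simps)
      finally show ?thesis using Suc.hyps by (simp add: ln_div)
    qed
    then show ?case using Suc.IH by (simp add: harm_Suc)
  qed
  also have "ln (real n) \<le> real n powr (1/8) / (1/8)"
    using assms by (intro ln_powr_bound) auto
  finally have "harm n \<le> 1 + 8 * real n powr (1/8)" by simp
  moreover have "1 \<le> real n powr (1/8)" using assms by (simp add: ge_one_powr_ge_zero)
  ultimately show ?thesis by simp
qed

section \<open>The Lame curve and its slope\<close>

text \<open>
  The first quadrant part of the curve \<open>t ^ k + u ^ k = X ^ k\<close> as a graph, together with the
  negative of its derivative. The point \<open>(Y, Y)\<close> is the intersection with the diagonal. All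
  constants in the estimates below depend on \<open>k\<close> only.
\<close>
locale lame_curve =
  fixes k :: nat and X :: real
  assumes k2: "2 \<le> k" and X1: "1 \<le> X"
begin

definition f :: "real \<Rightarrow> real" where "f t = (X ^ k - t ^ k) powr (1 / real k)"
definition slope :: "real \<Rightarrow> real" where "slope t = (t / f t) ^ (k - 1)"
definition Y :: real where "Y = X / 2 powr (1 / real k)"

lemma k_pos: "0 < k" and X_pos: "0 < X" using k2 X1 by auto

lemma Y_power: "Y ^ k = X ^ k / 2"
  using k_pos by (simp add: Y_def power_divide powr_realpow[symmetric] powr_powr)

lemma Y_pos: "0 < Y" using X_pos by (simp add: Y_def)

lemma Y_less: "Y < X" and X_le_2Y: "X \<le> 2 * Y"
proof -
  have "Y ^ k < X ^ k" using X_pos by (simp add: Y_power)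
  then show "Y < X" using X_pos power_less_imp_less_base by (metis less_imp_le)
  have "X ^ k \<le> 2 ^ k * Y ^ k"
    using mult_right_mono[of 2 "2 ^ k" "X ^ k"] X_pos k_pos self_le_power[of "2::real" k]
      by (simp add: Y_power)
  then show "X \<le> 2 * Y"
    using Y_pos k_pos by (metis mult_nonneg_nonneg power_mult_distrib power_mono_iff less_imp_le
      X_pos zero_le_numeral)
qed

lemma f_power:
  assumes "0 \<le> t" "t < X" shows "f t ^ k = X ^ k - t ^ k"
proof -
  have "0 < X ^ k - t ^ k" using assms k_pos by (simp add: power_strict_mono)
  then show ?thesis using k_pos by (simp add: f_def powr_realpow[symmetric] powr_powr)
qed

lemma f_pos:
  assumes "0 \<le> t" "t < X" shows "0 < f t"
proof -
  have "0 < X ^ k - t ^ k" using assms k_pos by (simp add: power_strict_mono)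
  then show ?thesis by (simp add: f_def)
qed

lemma f_antimono:
  assumes "0 \<le> s" "s \<le> t" "t \<le> X" shows "f t \<le> f s"
  unfolding f_def using assms by (intro powr_mono2) (auto intro: power_mono)

lemma f_le: assumes "0 \<le> t" "t \<le> X" shows "f t \<le> X"
proof -
  have "f t \<le> f 0" using assms by (intro f_antimono) auto
  also have "f 0 = X" using k_pos X_pos by
    (simp add: f_def power_0_left powr_realpow[symmetric] powr_powr)
  finally show ?thesis .
qed

lemma f_Y: "f Y = Y"
proof -
  have "f Y = (Y ^ k) powr (1 / real k)" by (simp add: f_def Y_power)
  then show ?thesis using k_pos Y_pos by (simp add: powr_realpow[symmetric] powr_powr)
qed

lemma Y_le_f: assumes "0 \<le> t" "t \<le> Y" shows "Y \<le> f t"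
  using f_antimono[of t Y] assms Y_less by (simp add: f_Y)

lemma f_has_derivative:
  assumes "0 \<le> t" "t < X"
  shows "(f has_real_derivative - slope t) (at t)"
proof -
  have pos: "0 < X ^ k - t ^ k" using assms k_pos by (simp add: power_strict_mono)
  have "(f has_real_derivative (1 / real k) * (X ^ k - t ^ k) powr (1 / real k - 1)
    * (- (real k * t ^ (k - 1)))) (at t)"
    unfolding f_def using pos by (auto intro!: derivative_eq_intros)
  also have "(1 / real k) * (X ^ k - t ^ k) powr (1 / real k - 1) * (- (real k * t ^ (k - 1)))
     = - (t ^ (k - 1) * (X ^ k - t ^ k) powr (1 / real k - 1))" using k_pos by simp
  also have "(X ^ k - t ^ k) powr (1 / real k - 1) = 1 / f t ^ (k - 1)"
  proof -
    have "f t ^ (k - 1) = (X ^ k - t ^ k) powr ((1 / real k) * real (k - 1))"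
      using pos unfolding f_def by (simp add: powr_realpow[symmetric] powr_powr)
    also have "(1 / real k) * real (k - 1) = - (1 / real k - 1)"
      using k_pos by (simp add: field_simps of_nat_diff)
    finally show ?thesis by (simp only: powr_minus) (simp add: field_simps)
  qed
  finally show ?thesis by (simp add: slope_def power_divide)
qed

lemma slope_nonneg: assumes "0 \<le> t" "t < X" shows "0 \<le> slope t"
  using f_pos[OF assms] assms by (simp add: slope_def)

lemma slope_pos: assumes "0 < t" "t < X" shows "0 < slope t"
  using f_pos[of t] assms by (simp add: slope_def)

text \<open>
  A lower bound for the growth of the slope that replaces a lower bound for the second
  derivative: between \<open>s\<close> and \<open>t\<close> the slope grows by at least the factor \<open>t / s\<close>.
\<close>
lemma slope_over_id_mono:
  assumes "0 < s" "s \<le> t" "t < X" shows "slope s / s \<le> slope t / t"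
proof -
  have eq: "slope u / u = u ^ (k - 2) / f u ^ (k - 1)" if "0 < u" for u
  proof -
    have "u ^ (k - 1) = u * u ^ (k - 2)" using k2
      by (metis Suc_diff_le diff_Suc_1 diff_Suc_Suc numeral_2_eq_2 power_Suc Suc_1)
    then show ?thesis using that by (simp add: slope_def power_divide)
  qed
  have "s ^ (k - 2) / f s ^ (k - 1) \<le> t ^ (k - 2) / f t ^ (k - 1)"
    using assms f_pos[of t] f_antimono[of s t]
      by (intro frac_le power_mono) (auto intro: less_imp_le)
  then show ?thesis using eq assms by simp
qed

lemma slope_mono:
  assumes "0 \<le> s" "s \<le> t" "t < X" shows "slope s \<le> slope t"
  unfolding slope_def using assms f_pos[of t] f_pos[of s] f_antimono[of s t]
  by (intro power_mono frac_le) auto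

lemma slope_ge: assumes "0 \<le> t" "t < X" shows "(t / X) ^ (k - 1) \<le> slope t"
  unfolding slope_def using assms f_pos[of t] f_le[of t] by (intro power_mono frac_le) auto

lemma slope_le_1: assumes "0 \<le> t" "t \<le> Y" shows "slope t \<le> 1"
proof -
  have "slope t \<le> slope Y" using assms Y_less by (intro slope_mono) auto
  then show ?thesis using Y_pos by (simp add: slope_def f_Y)
qed

lemma slope_le: assumes "0 \<le> t" "t \<le> Y" shows "slope t \<le> 2 * (t / X) ^ (k - 1)"
proof -
  have "slope t \<le> (t / Y) ^ (k - 1)"
    unfolding slope_def using assms Y_pos Y_le_f[of t] by (intro power_mono frac_le) auto
  also have "\<dots> = (X / Y) ^ (k - 1) * (t / X) ^ (k - 1)"
    using X_pos by (simp add: power_mult_distrib[symmetric])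
  also have "\<dots> \<le> 2 * (t / X) ^ (k - 1)"
  proof (rule mult_right_mono)
    have "(X / Y) ^ (k - 1) \<le> (X / Y) ^ k"
      using Y_less Y_pos by (intro power_increasing) auto
    also have "\<dots> = 2" using X_pos by (simp add: power_divide Y_power)
    finally show "(X / Y) ^ (k - 1) \<le> 2" .
  qed (use assms X_pos in auto)
  finally show ?thesis .
qed

lemma f_increment:
  assumes "0 \<le> s" "s < t" "t < X"
  shows "\<exists>\<xi>. slope s \<le> \<xi> \<and> \<xi> \<le> slope t \<and> f t = f s - (t - s) * \<xi>"
proof -
  have "\<exists>z. s < z \<and> z < t \<and> f t - f s = (t - s) * (- slope z)"
    using assms by (intro MVT2) (auto intro: f_has_derivative)
  then obtain z where z: "s < z" "z < t" "f t - f s = (t - s) * (- slope z)" by blast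
  then show ?thesis using assms by (intro exI[of _ "slope z"]) (auto intro: slope_mono)
qed

text \<open>
  On \<open>{0..Y}\<close> both \<open>t\<close> and \<open>1 / f t\<close> vary slowly, because \<open>f\<close> is at least \<open>Y \<ge> X / 2\<close> and
  has slope at most 1 there. Hence the ratio \<open>t / f t \<le> 1\<close> has Lipschitz constant \<open>4 / X\<close>,
  and taking the power \<open>k - 1\<close> costs at most a factor \<open>k\<close>.
\<close>
lemma slope_lipschitz:
  assumes "0 \<le> s" "s \<le> t" "t \<le> Y"
  shows "slope t - slope s \<le> 4 * real k / X * (t - s)"
proof (cases "s = t")
  case False
  define a b where "a = s / f s" and "b = t / f t"
  have pos: "0 < f s" "0 < f t" using assms Y_pos Y_le_f[of s] Y_le_f[of t] by auto
  have fs: "Y \<le> f s" "Y \<le> f t" using assms Y_le_f[of s] Y_le_f[of t] by auto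
  have ab: "0 \<le> a" "a \<le> b" "b \<le> 1"
    using assms pos fs f_antimono[of s t] Y_less by (auto simp: a_def b_def intro!: frac_le)
  obtain \<xi> where xi: "\<xi> \<le> slope t" "f t = f s - (t - s) * \<xi>"
    using f_increment[of s t] assms False Y_less by auto
  have "(t - s) * \<xi> \<le> (t - s) * 1" using xi slope_le_1[of t] assms by (intro mult_left_mono) auto
  then have d: "f s - f t \<le> t - s" using xi by simp
  have "b - a = (t - s) / f t + a * (f s - f t) / f t"
    using pos by (simp add: a_def b_def field_simps)
  also have "\<dots> \<le> (t - s) / f t + 1 * (t - s) / f t"
    using d pos ab assms f_antimono[of s t] Y_less
    by (intro add_left_mono divide_right_mono mult_mono) auto
  also have "\<dots> = 2 * (t - s) / f t" by simp
  also have "\<dots> \<le> 2 * (t - s) / (X / 2)"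
    using assms fs X_le_2Y X_pos by (intro divide_left_mono) auto
  finally have ba: "b - a \<le> 4 / X * (t - s)" by simp
  have bern: "b ^ n - a ^ n \<le> real n * (b - a)" for n
  proof (induction n)
    case (Suc n)
    have "b ^ Suc n - a ^ Suc n = b * (b ^ n - a ^ n) + a ^ n * (b - a)"
      by (simp add: algebra_simps)
    also have "\<dots> \<le> 1 * (b ^ n - a ^ n) + 1 * (b - a)"
      using ab by (intro add_mono mult_right_mono) (auto intro: power_mono power_le_one)
    finally show ?case using Suc by (simp add: algebra_simps)
  qed simp
  have "slope t - slope s \<le> real (k - 1) * (b - a)"
    using bern[of "k - 1"] by (simp add: slope_def a_def b_def)
  also have "\<dots> \<le> real k * (4 / X * (t - s))" using ba ab assms by (intro mult_mono) auto
  finally show ?thesis by (simp add: algebra_simps)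
qed simp

definition M :: nat where "M = nat \<lfloor>Y\<rfloor>"

lemma M_le: "real M \<le> Y" using Y_pos by (simp add: M_def of_nat_floor)

text \<open>
  By the mean value theorem the chord slopes on the block lie between the slopes at its ends, so
  the curve differs from the line of slope \<open>a/q\<close> by at most \<open>q\<close> times the variation of the
  slope plus its initial distance from \<open>a/q\<close>.
\<close>
lemma sum_sawtooth_block:
  assumes "coprime a (int q)" "0 < q" "m + q \<le> M"
  shows "\<bar>\<Sum>n=m..<m+q. sawtooth (f (real n))\<bar> \<le>
     1/2 + 2 * (real q ^ 2 * (slope (real (m + q)) - slope (real m)) + real q ^ 2
       * \<bar>slope (real m) - of_int a / real q\<bar>)"
proof -
  define E where "E = slope (real (m + q)) - slope (real m) + \<bar>slope (real m) - of_int a / real q\<bar>"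
  have mq: "real (m + q) < X" using assms(3) M_le Y_less by linarith
  have near: "\<bar>f (real (m + j)) - (f (real m) - of_int a * real j / real q)\<bar> \<le> real q * E"
    if "j < q" for j
  proof -
    have "\<exists>\<xi>. slope (real m) \<le> \<xi> \<and> \<xi> \<le> slope (real (m + q)) \<and> f (real (m + j)) = f (real m)
      - real j * \<xi>"
    proof (cases "j = 0")
      case True then show ?thesis using mq
        by (intro exI[of _ "slope (real m)"]) (auto intro: slope_mono)
    next
      case False
      have mj: "real m + real j < X" using mq that by simp
      from False obtain \<xi> where "slope (real m) \<le> \<xi>" "\<xi> \<le> slope (real (m + j))"
         "f (real (m + j)) = f (real m) - real j * \<xi>"
        using f_increment[of "real m" "real (m + j)"] mj by auto
      moreover have "slope (real (m + j)) \<le> slope (real (m + q))" using mq that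
        by (intro slope_mono) auto
      ultimately show ?thesis by force
    qed
    then obtain \<xi> where xi: "slope (real m) \<le> \<xi>" "\<xi> \<le> slope (real (m + q))"
      "f (real (m + j)) = f (real m) - real j * \<xi>" by blast
    have "f (real (m + j)) - (f (real m) - of_int a * real j / real q) = real j
      * (of_int a / real q - \<xi>)"
      by (simp only: xi(3)) (simp add: algebra_simps)
    then have "\<bar>f (real (m + j)) - (f (real m) - of_int a * real j / real q)\<bar> = real j
      * \<bar>of_int a / real q - \<xi>\<bar>"
      by (simp add: abs_mult)
    also have "\<dots> \<le> real q * E"
      using that xi by (intro mult_mono) (auto simp: E_def)
    finally show ?thesis .
  qed
  have "(\<Sum>n=m..<m+q. sawtooth (f (real n))) = (\<Sum>j<q. sawtooth (f (real (m + j))))"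
    using sum.shift_bounds_nat_ivl[of "\<lambda>n. sawtooth (f (real n))" 0 m q]
      by (simp add: atLeast0LessThan add.commute)
  also have "\<bar>\<dots>\<bar> \<le> 1/2 + 2 * real q * (real q * E)"
    by (rule sum_sawtooth_near_rational_line[OF assms(1,2) near])
  finally show ?thesis by (simp add: E_def power2_eq_square algebra_simps)
qed

section \<open>The sawtooth sum along the Lame curve\<close>

text \<open>
  Blocks of length \<open>q = \<lceil>1 / slope m\<rceil>\<close> with \<open>a = 1\<close>. The curve drops by at least 1 along such
  a block, so the constant part of the cost is at most a multiple of the sum of the slopes over
  the block. The variable part \<open>q\<^sup>2 (\<alpha>' - \<alpha>)\<close>, with \<open>\<alpha>\<close> and \<open>\<alpha>'\<close> the slopes at the two
  ends, is comparable to \<open>1/\<alpha> - 1/\<alpha>'\<close> and telescopes. The comparison needs \<open>\<alpha>' = O(\<alpha>)\<close>, that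
  is \<open>q = O(m)\<close>; this is what \<open>X ^ (k - 1) \<le> m0 ^ k\<close> provides.
\<close>
lemma sum_sawtooth_small_slope:
  assumes m0: "X ^ (k - 1) \<le> real m0 ^ k" "0 < m0" and m1: "m0 \<le> m1" "m1 \<le> M"
    and small: "\<And>n. n < m1 \<Longrightarrow> slope (real n) \<le> \<delta>"
  shows "\<bar>\<Sum>n=m0..<m1. sawtooth (f (real n))\<bar> \<le> 9/2 * \<delta> * X + (16 * 3 ^ (k - 1) + 2)
    * (X / real m0) ^ (k - 1)"
proof -
  \<comment> \<open>A block starting at \<open>m\<close> ends at \<open>3 m\<close> at the latest, and on that stretch the slope grows at
    most by
     the factor \<open>K\<close>.\<close>
  define K :: real where "K = 2 * 3 ^ (k - 1)"
  define w where "w n = 9/2 * slope (real n) + 8 * K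
    * (1 / slope (real n) - 1 / slope (real (Suc n)))" for n :: nat
  \<comment> \<open>\<open>B\<close> bounds the reciprocal of every slope that occurs.\<close>
  define B where "B = (X / real m0) ^ (k - 1)"
  have K: "0 < K" by (simp add: K_def)
  have lt: "real n < X" if "n \<le> M" for n using that M_le Y_less by linarith
  have sp: "0 < slope (real n)" if "m0 \<le> n" "n \<le> M" for n using that lt m0 by (intro slope_pos) auto
  have sinv: "1 / slope (real n) \<le> B" if "m0 \<le> n" "n \<le> M" for n
  proof -
    have "1 / slope (real n) \<le> 1 / (real n / X) ^ (k - 1)"
      using that lt[of n] m0 X_pos by (intro divide_left_mono slope_ge)
        (auto intro!: mult_pos_pos sp)
    also have "\<dots> \<le> 1 / (real m0 / X) ^ (k - 1)"
      using that m0 X_pos by (intro divide_left_mono power_mono divide_right_mono) auto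
    finally show ?thesis by (simp add: B_def power_divide)
  qed
  have B0: "0 \<le> B" using X_pos by (simp add: B_def)
  have "\<bar>\<Sum>n=m0..<m1. sawtooth (f (real n))\<bar> \<le> (\<Sum>n=m0..<m1. w n) + 2 * B"
  proof (rule abs_sum_le_by_blocks)
    fix n assume n: "m0 \<le> n" "n < m1"
    have "slope (real n) \<le> slope (real (Suc n))" using lt[of "Suc n"] n m1
      by (intro slope_mono) auto
    then have "1 / slope (real (Suc n)) \<le> 1 / slope (real n)"
      using sp[of n] sp[of "Suc n"] n m1 by (intro divide_left_mono) auto
    then show "0 \<le> w n" using sp[of n] n m1 K
      by (auto simp: w_def intro!: add_nonneg_nonneg mult_nonneg_nonneg)
  next
    show "0 \<le> 2 * B" using B0 by simp
  next
    fix m assume m: "m0 \<le> m" "m < m1"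
    define \<alpha> where "\<alpha> = slope (real m)"
    have \<alpha>: "0 < \<alpha>" "\<alpha> \<le> 1" using sp[of m] m m1 M_le by (auto simp: \<alpha>_def intro!: slope_le_1)
    define q where "q = nat \<lceil>1 / \<alpha>\<rceil>"
    have q1: "1 / \<alpha> \<le> real q" "real q < 1 / \<alpha> + 1"
      using \<alpha> unfolding q_def by (auto simp: real_nat_ceiling_ge) (use \<alpha> in linarith)
    have q0: "0 < q" using q1(1) \<alpha> by (cases q) (auto simp: field_simps)
    have q2: "real q \<le> 2 / \<alpha>" using q1 \<alpha> by (simp add: field_simps)
    show "\<bar>\<Sum>n=m..<m1. sawtooth (f (real n))\<bar> \<le> 2 * B \<or>
       (\<exists>q>0. m + q \<le> m1 \<and> \<bar>\<Sum>n=m..<m+q. sawtooth (f (real n))\<bar> \<le> (\<Sum>n=m..<m+q. w n))"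
    proof (cases "m + q \<le> m1")
      case False
      have "\<bar>\<Sum>n=m..<m1. sawtooth (f (real n))\<bar> \<le> (\<Sum>n=m..<m1. \<bar>sawtooth (f (real n))\<bar>)"
        by (rule sum_abs)
      also have "\<dots> \<le> (\<Sum>n=m..<m1. 1)"
        by (intro sum_mono order_trans[OF abs_sawtooth_le]) auto
      also have "\<dots> \<le> real q" using False by simp
      also have "\<dots> \<le> 2 * (1 / \<alpha>)" using q2 by simp
      also have "\<dots> \<le> 2 * B" unfolding \<alpha>_def using sinv[of m] m m1 by (intro mult_left_mono) auto
      finally show ?thesis by blast
    next
      case True
      define \<alpha>' where "\<alpha>' = slope (real (m + q))"
      have mq: "m0 \<le> m + q" "m + q \<le> M" using True m m1 by auto
      have \<alpha>': "\<alpha> \<le> \<alpha>'" unfolding \<alpha>_def \<alpha>'_def using lt[OF mq(2)] by (intro slope_mono) auto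
      have q_le: "real q \<le> 2 * real m"
      proof -
        have mpos: "0 < real m" using m m0 by simp
        have "real q \<le> 2 * (1 / \<alpha>)" using q2 by simp
        also have "1 / \<alpha> \<le> 1 / (real m / X) ^ (k - 1)"
          unfolding \<alpha>_def using lt[of m] m m0 m1 X_pos
            by (intro divide_left_mono slope_ge) (auto intro!: mult_pos_pos sp)
        also have "1 / (real m / X) ^ (k - 1) = X ^ (k - 1) / real m ^ (k - 1)"
          by (simp add: power_divide)
        also have "\<dots> \<le> real m ^ k / real m ^ (k - 1)"
          using m0 m by (intro divide_right_mono order_trans[OF m0(1)] power_mono) auto
        also have "\<dots> = real m" using mpos k_pos by (simp add: power_diff)
        finally show ?thesis by simp
      qed
      have \<alpha>'K: "\<alpha>' \<le> K * \<alpha>"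
      proof -
        have "\<alpha>' \<le> 2 * (real (m + q) / X) ^ (k - 1)"
          unfolding \<alpha>'_def using mq M_le by (intro slope_le) auto
        also have "\<dots> \<le> 2 * (3 * (real m / X)) ^ (k - 1)"
          using q_le X_pos by (intro mult_left_mono power_mono) (auto simp: divide_right_mono)
        also have "\<dots> = K * (real m / X) ^ (k - 1)"
          by (simp only: K_def power_mult_distrib mult.assoc)
        also have "\<dots> \<le> K * \<alpha>" unfolding \<alpha>_def using lt[of m] m m1 K
          by (intro mult_left_mono slope_ge) auto
        finally show ?thesis .
      qed
      have "\<bar>\<Sum>n=m..<m+q. sawtooth (f (real n))\<bar> \<le>
          1/2 + 2 * (real q ^ 2 * (\<alpha>' - \<alpha>) + real q ^ 2 * \<bar>\<alpha> - of_int 1 / real q\<bar>)"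
        unfolding \<alpha>_def \<alpha>'_def using q0 mq by (intro sum_sawtooth_block) auto
      also have "real q ^ 2 * \<bar>\<alpha> - of_int 1 / real q\<bar> \<le> 2"
      proof -
        have qa: "1 \<le> real q * \<alpha>" "real q * \<alpha> \<le> 1 + \<alpha>" using q1 \<alpha> by (auto simp: field_simps)
        have "real q ^ 2 * \<bar>\<alpha> - of_int 1 / real q\<bar> = real q * \<bar>real q * \<alpha> - 1\<bar>"
          using q0 by (simp add: power2_eq_square abs_mult[symmetric] field_simps)
        also have "\<dots> \<le> real q * \<alpha>" using qa q0 by (intro mult_left_mono) auto
        also have "\<dots> \<le> 2" using qa \<alpha> by simp
        finally show ?thesis .
      qed
      also have "real q ^ 2 * (\<alpha>' - \<alpha>) \<le> 4 * K * (1 / \<alpha> - 1 / \<alpha>')"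
      proof -
        have a'pos: "0 < \<alpha>'" using \<alpha> \<alpha>' by simp
        have "real q ^ 2 * (\<alpha>' - \<alpha>) \<le> (2 / \<alpha>) ^ 2 * (\<alpha>' - \<alpha>)"
          using q2 \<alpha>' by (intro mult_right_mono power_mono) auto
        also have "\<dots> = 4 * (\<alpha>' / \<alpha>) * (1 / \<alpha> - 1 / \<alpha>')"
          using \<alpha> a'pos by (simp add: field_simps power2_eq_square)
        also have "\<dots> \<le> 4 * K * (1 / \<alpha> - 1 / \<alpha>')"
          using \<alpha>'K \<alpha> \<alpha>' a'pos by (intro mult_right_mono mult_left_mono) (auto simp: field_simps)
        finally show ?thesis .
      qed
      finally have cost: "\<bar>\<Sum>n=m..<m+q. sawtooth (f (real n))\<bar> \<le> 9/2 + 8 * K * (1 / \<alpha> - 1 / \<alpha>')"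
        by (simp add: algebra_simps)
      have "1 \<le> real q * \<alpha>" using q1 \<alpha> by (auto simp: field_simps)
      also have "\<dots> = (\<Sum>n=m..<m+q. \<alpha>)" by simp
      also have "\<dots> \<le> (\<Sum>n=m..<m+q. slope (real n))"
        unfolding \<alpha>_def using mq lt by (intro sum_mono slope_mono) auto
      finally have one: "1 \<le> (\<Sum>n=m..<m+q. slope (real n))" .
      have "(\<Sum>n=m..<m+q. 1 / slope (real n) - 1 / slope (real (Suc n))) = 1 / \<alpha> - 1 / \<alpha>'"
        using sum_Suc_diff'[of m "m+q" "\<lambda>n. - (1 / slope (real n))"] by (simp add: \<alpha>_def \<alpha>'_def)
      then have "(\<Sum>n=m..<m+q. w n) = 9/2 * (\<Sum>n=m..<m+q. slope (real n)) + 8 * K * (1 / \<alpha> - 1 / \<alpha>')"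
        unfolding w_def by (simp only: sum.distrib sum_distrib_left[symmetric])
      with cost one have "\<bar>\<Sum>n=m..<m+q. sawtooth (f (real n))\<bar> \<le> (\<Sum>n=m..<m+q. w n)" by linarith
      with True q0 show ?thesis by blast
    qed
  qed
  also have "(\<Sum>n=m0..<m1. w n) \<le> 9/2 * \<delta> * X + 8 * K * B"
  proof -
    have "slope (real 0) = 0" using k2 by (simp add: slope_def)
    then have d0: "0 \<le> \<delta>" using small[of 0] m0 m1 by simp
    have "(\<Sum>n=m0..<m1. slope (real n)) \<le> (\<Sum>n=m0..<m1. \<delta>)" using small by (intro sum_mono) auto
    also have "\<dots> = real (m1 - m0) * \<delta>" by simp
    also have "\<dots> \<le> X * \<delta>"
      using d0 lt[of m1] m1 by (intro mult_right_mono) auto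
    finally have s: "(\<Sum>n=m0..<m1. slope (real n)) \<le> X * \<delta>" .
    have "(\<Sum>n=m0..<m1. 1 / slope (real n) - 1 / slope (real (Suc n))) = 1 / slope (real m0)
      - 1 / slope (real m1)"
      using sum_Suc_diff'[of m0 m1 "\<lambda>n. - (1 / slope (real n))"] m1 by simp
    moreover have "0 \<le> 1 / slope (real m1)" using sp[of m1] m1 by simp
    ultimately have t: "(\<Sum>n=m0..<m1. 1 / slope (real n) - 1 / slope (real (Suc n))) \<le> B"
      using sinv[of m0] m1 by linarith
    have "(\<Sum>n=m0..<m1. w n) = 9/2 * (\<Sum>n=m0..<m1. slope (real n)) + 8 * K
      * (\<Sum>n=m0..<m1. 1 / slope (real n) - 1 / slope (real (Suc n)))"
      unfolding w_def by (simp only: sum.distrib sum_distrib_left[symmetric])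
    also have "\<dots> \<le> 9/2 * (X * \<delta>) + 8 * K * B"
      using s t K by (intro add_mono mult_left_mono) auto
    finally show ?thesis by (simp add: mult_ac)
  qed
  finally show ?thesis unfolding B_def K_def by (simp add: algebra_simps)
qed

text \<open>
  Dirichlet approximation of the slope at \<open>m\<close> gives a fraction \<open>a/q\<close> with \<open>q \<le> Q\<close>. The
  condition \<open>Q ^ 3 \<le> X\<close> keeps the curvature from destroying the approximation along \<open>q\<close>
  steps, so each block costs \<open>O(k)\<close>. The number of blocks is controlled by counting, for each
  fraction, the \<open>n\<close> whose slope is close to it.
\<close>
lemma sum_sawtooth_large_slope:
  fixes Q :: nat
  assumes Q: "1 \<le> Q" "real Q ^ 3 \<le> X" and m1: "m1 \<le> M"
    and large: "\<And>n. m1 \<le> n \<Longrightarrow> n < M \<Longrightarrow> 1 / real Q \<le> slope (real n)"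
  shows "\<bar>\<Sum>n=m1..<M. sawtooth (f (real n))\<bar> \<le> 10 * real k * (X / real Q)
    * (3 + 20 * real k * harm (2 * Q) ^ 2)"
proof -
  define C where "C = 5 * real k"
  define A where "A q a = {n. n \<in> {m1..<M} \<and> real a / (2 * real q) \<le> slope (real n) \<and>
     \<bar>slope (real n) - real a / real q\<bar> \<le> C / (real q * real Q)}" for q a :: nat
  define I where "I = {1..Q} \<times> {1..2*Q}"
  \<comment> \<open>A block attached to \<open>a/q\<close> has \<open>q\<close> points, all of them in \<open>A q a\<close>, each paying \<open>1/q\<close>
     of the cost \<open>10 k\<close> of the block.\<close>
  define w where "w n = 10 * real k * (\<Sum>(q,a)\<in>I. 1 / real q * indicator (A q a) n)" for n :: nat
  have Q0: "0 < real Q" using Q by simp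
  have QX: "real Q \<le> X / real Q"
  proof -
    have "real Q ^ 2 \<le> real Q ^ 3" using Q by (intro power_increasing) auto
    then show ?thesis using Q Q0 by (simp add: field_simps power2_eq_square)
  qed
  have lt: "real n < X" if "n \<le> M" for n using that M_le Y_less by linarith
  have "\<bar>\<Sum>n=m1..<M. sawtooth (f (real n))\<bar> \<le> (\<Sum>n=m1..<M. w n) + real Q"
  proof (rule abs_sum_le_by_blocks)
    show "0 \<le> w n" for n by (auto simp: w_def intro!: mult_nonneg_nonneg sum_nonneg)
    show "0 \<le> real Q" by simp
    fix m assume m: "m1 \<le> m" "m < M"
    obtain a' q' where aq': "coprime a' q'" "0 < q'" "q' \<le> int Q"
      "\<bar>of_int q' * slope (real m) - of_int a'\<bar> < 1 / real Q"
      using Dirichlet_approx_coprime[of Q "slope (real m)"] Q by auto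
    define q where "q = nat q'"
    have q: "0 < q" "q \<le> Q" "q' = int q" using aq' by (auto simp: q_def)
    have sl: "1 / real Q \<le> slope (real m)" "slope (real m) \<le> 1"
      using large m M_le by (auto intro!: slope_le_1)
    have appr: "\<bar>real q * slope (real m) - of_int a'\<bar> < 1 / real Q" using aq' q by simp
    \<comment> \<open>The fraction 0 is excluded because the slope is at least \<open>1/Q\<close>.\<close>
    have "0 < a'"
    proof -
      have "1 * (1 / real Q) \<le> real q * slope (real m)" using q sl by (intro mult_mono) auto
      then have "0 < real_of_int a'" using appr by linarith
      then show ?thesis by simp
    qed
    define a where "a = nat a'"
    have a: "0 < a" "a' = int a" using \<open>0 < a'\<close> by (auto simp: a_def)
    have appr: "\<bar>real q * slope (real m) - real a\<bar> < 1 / real Q" using appr a by simp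
    have a_le: "a \<le> 2 * Q"
    proof -
      have "real q * slope (real m) \<le> real q * 1" using sl by (intro mult_left_mono) auto
      moreover have "1 / real Q \<le> 1" using Q by simp
      ultimately have "real a < real q + 1" using appr by linarith
      then show ?thesis using q by linarith
    qed
    have qpos: "0 < real q" using q by simp
    have appr': "\<bar>slope (real m) - real a / real q\<bar> \<le> 1 / (real q * real Q)"
    proof -
      have "real q * \<bar>slope (real m) - real a / real q\<bar> = \<bar>real q * slope (real m) - real a\<bar>"
        using qpos by (simp add: abs_mult[symmetric] field_simps)
      with appr have "real q * \<bar>slope (real m) - real a / real q\<bar> \<le> 1 / real Q" by simp
      then show ?thesis using qpos by (simp add: field_simps)
    qed
    have half: "real a / (2 * real q) \<le> slope (real m)"
    proof -
      have "real a \<le> real q * slope (real m) + 1 / real Q" using appr by linarith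
      also have "1 / real Q \<le> real q * slope (real m)"
        using mult_mono[of 1 "real q" "1 / real Q" "slope (real m)"] q sl by simp
      finally show ?thesis using qpos by (simp add: field_simps)
    qed
    show "\<bar>\<Sum>n=m..<M. sawtooth (f (real n))\<bar> \<le> real Q \<or>
       (\<exists>q>0. m + q \<le> M \<and> \<bar>\<Sum>n=m..<m+q. sawtooth (f (real n))\<bar> \<le> (\<Sum>n=m..<m+q. w n))"
    proof (cases "m + q \<le> M")
      case False
      have "\<bar>\<Sum>n=m..<M. sawtooth (f (real n))\<bar> \<le> (\<Sum>n=m..<M. \<bar>sawtooth (f (real n))\<bar>)"
        by (rule sum_abs)
      also have "\<dots> \<le> (\<Sum>n=m..<M. 1)"
        by (intro sum_mono order_trans[OF abs_sawtooth_le]) auto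
      also have "\<dots> \<le> real Q" using False q by simp
      finally show ?thesis by blast
    next
      case True
      have lip: "slope (real n) - slope (real m) \<le> 4 * real k / X * real q"
        if "m \<le> n" "n \<le> m + q" for n
      proof -
        have "real n \<le> Y" using that True M_le by linarith
        then have "slope (real n) - slope (real m) \<le> 4 * real k / X * (real n - real m)"
          using that by (intro slope_lipschitz) auto
        also have "\<dots> \<le> 4 * real k / X * real q" using that X_pos by (intro mult_left_mono) auto
        finally show ?thesis .
      qed
      have q3: "real q ^ 2 * real Q \<le> X"
      proof -
        have "real q ^ 2 * real Q \<le> real Q ^ 2 * real Q" using q
          by (intro mult_right_mono power_mono) auto
        also have "\<dots> = real Q ^ 3" by (simp add: power3_eq_cube power2_eq_square)
        finally show ?thesis using Q(2) by simp
      qed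
      have "\<bar>\<Sum>n=m..<m+q. sawtooth (f (real n))\<bar> \<le> 1/2 + 2
        * (real q ^ 2 * (slope (real (m + q)) - slope (real m)) + real q ^ 2 * \<bar>slope (real m)
        - of_int (int a) / real q\<bar>)"
        using aq' a q True by (intro sum_sawtooth_block) auto
      also have "real q ^ 2 * \<bar>slope (real m) - of_int (int a) / real q\<bar> \<le> real q ^ 2
        * (1 / (real q * real Q))"
        using appr' by (intro mult_left_mono) auto
      also have "\<dots> = real q / real Q" using qpos by (simp add: power2_eq_square)
      also have "\<dots> \<le> 1" using q by simp
      also have "real q ^ 2 * (slope (real (m + q)) - slope (real m)) \<le> real q ^ 2
        * (4 * real k / X * real q)"
        using lip[of "m+q"] by (intro mult_left_mono) auto
      also have "\<dots> \<le> 4 * real k"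
      proof -
        have "real q ^ 2 * real q \<le> real q ^ 2 * real Q" using q by (intro mult_left_mono) auto
        with q3 have "real q ^ 2 * real q / X \<le> 1" using X_pos by simp
        then have "4 * real k * (real q ^ 2 * real q / X) \<le> 4 * real k * 1"
          by (intro mult_left_mono) auto
        then show ?thesis by (simp add: mult_ac)
      qed
      also have "1/2 + 2 * (4 * real k + 1) \<le> 10 * real k" using k2 by simp
      finally have cost: "\<bar>\<Sum>n=m..<m+q. sawtooth (f (real n))\<bar> \<le> 10 * real k" by simp
      have inA: "n \<in> A q a" if n: "n \<in> {m..<m+q}" for n
      proof -
        have mono: "slope (real m) \<le> slope (real n)" using n True lt[of n]
          by (intro slope_mono) auto
        have "4 * real k / X * real q \<le> 4 * real k / (real q * real Q)"
        proof -
          have "real q / X \<le> 1 / (real q * real Q)" using q3 qpos Q0 X_pos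
            by (simp add: field_simps power2_eq_square)
          then have "4 * real k * (real q / X) \<le> 4 * real k * (1 / (real q * real Q))"
            by (intro mult_left_mono) auto
          then show ?thesis by simp
        qed
        then have "slope (real n) - slope (real m) \<le> 4 * real k / (real q * real Q)"
          using lip[of n] n by simp
        with appr' mono have "\<bar>slope (real n) - real a / real q\<bar> \<le> 1 / (real q * real Q) + 4
          * real k / (real q * real Q)"
          by linarith
        also have "\<dots> = (1 + 4 * real k) / (real q * real Q)" by (simp add: add_divide_distrib)
        also have "\<dots> \<le> C / (real q * real Q)" using k2
          by (intro divide_right_mono) (auto simp: C_def)
        finally show ?thesis using half mono n m True by (auto simp: A_def)
      qed
      have qaI: "(q, a) \<in> I" using q a a_le by (auto simp: I_def)
      have "10 * real k = (\<Sum>n=m..<m+q. 10 * real k * (1 / real q))" using qpos by simp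
      also have "\<dots> \<le> (\<Sum>n=m..<m+q. w n)"
      proof (rule sum_mono)
        fix n assume n: "n \<in> {m..<m+q}"
        have "(\<lambda>(q,a). 1 / real q * indicator (A q a) n :: real) (q, a)
          \<le> (\<Sum>(q,a)\<in>I. 1 / real q * indicator (A q a) n)"
          by (rule member_le_sum[OF qaI]) (auto simp: I_def)
        then show "10 * real k * (1 / real q) \<le> w n"
          unfolding w_def using inA[OF n] by (intro mult_left_mono) auto
      qed
      finally show ?thesis using cost True q by (intro disjI2 exI[of _ q]) auto
    qed
  qed
  also have "(\<Sum>n=m1..<M. w n) \<le> 10 * real k * (X / real Q) * (2 + 20 * real k * harm (2 * Q) ^ 2)"
  proof -
    \<comment> \<open>On \<open>A q a\<close> the slope is at least \<open>a / (2 q)\<close>, hence it grows at least at the rate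
       \<open>a / (2 q X)\<close>, while it varies by at most \<open>2 C / (q Q)\<close>.\<close>
    have cardA: "real (card (A q a)) \<le> 4 * C * X / (real a * real Q) + 1" if "(q, a) \<in> I" for q a
    proof (rule card_le_of_diff_bounded)
      show "finite (A q a)" by (simp add: A_def)
      show "0 \<le> 4 * C * X / (real a * real Q)" using X_pos by (simp add: C_def)
      fix m n assume mn: "m \<in> A q a" "n \<in> A q a" "m \<le> n"
      have qa: "0 < real q" "0 < real a" using that by (auto simp: I_def)
      have pos: "0 < real m"
      proof (rule ccontr)
        assume "\<not> 0 < real m"
        then have "slope (real m) = 0" using k2 by (simp add: slope_def)
        then show False using mn qa by (simp add: A_def field_simps)
      qed
      have nX: "real n < X" using mn lt by (auto simp: A_def)
      have "slope (real m) / real m \<le> slope (real n) / real n"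
        using mn pos nX by (intro slope_over_id_mono) auto
      then have "slope (real m) / real m * (real n - real m) \<le> slope (real n) - slope (real m)"
        using pos mn by (simp add: field_simps)
      also have "\<dots> \<le> 2 * C / (real q * real Q)" using mn by (auto simp: A_def)
      finally have 1: "slope (real m) / real m * (real n - real m) \<le> 2 * C / (real q * real Q)" .
      have "real a / (2 * real q) / X \<le> slope (real m) / real m"
      proof (rule frac_le)
        show "0 \<le> slope (real m)" using mn nX by (intro slope_nonneg) auto
        show "real m \<le> X" using mn nX by simp
      qed (use mn pos in \<open>auto simp: A_def\<close>)
      then have "real a / (2 * real q) / X * (real n - real m) \<le> 2 * C / (real q * real Q)"
        using mn by (intro order_trans[OF mult_right_mono 1]) auto
      then have "(2 * real q * X / real a) * (real a / (2 * real q) / X * (real n - real m))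
        \<le> (2 * real q * X / real a) * (2 * C / (real q * real Q))"
        using X_pos by (intro mult_left_mono) auto
      moreover have "(2 * real q * X / real a) * (real a / (2 * real q) / X * (real n - real m))
        = real n - real m"
        using qa X_pos by simp
      moreover have "(2 * real q * X / real a) * (2 * C / (real q * real Q)) = 4 * C
        * X / (real a * real Q)"
        using qa by simp
      ultimately show "real n - real m \<le> 4 * C * X / (real a * real Q)" by linarith
    qed
    have "(\<Sum>n=m1..<M. w n) = 10 * real k
      * (\<Sum>(q,a)\<in>I. 1 / real q * (\<Sum>n=m1..<M. indicator (A q a) n))"
      unfolding w_def sum_distrib_left[symmetric]
      by (subst sum.swap) (simp add: case_prod_unfold sum_distrib_left)
    also have "(\<Sum>(q,a)\<in>I. 1 / real q * (\<Sum>n=m1..<M. indicator (A q a) n))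
      = (\<Sum>(q,a)\<in>I. 1 / real q * real (card (A q a)))"
    proof -
      have "(\<Sum>n=m1..<M. indicator (A q a) n) = real (card (A q a))" for q a
      proof -
        have "{m1..<M} \<inter> {n. n \<in> A q a} = A q a" by (auto simp: A_def)
        then show ?thesis by (simp add: indicator_def sum.If_cases)
      qed
      then show ?thesis by simp
    qed
    also have "\<dots> \<le> (\<Sum>(q,a)\<in>I. 1 + 4 * C * X / real Q * (1 / real q * (1 / real a)))"
    proof (rule sum_mono, clarify)
      fix q a assume qa: "(q, a) \<in> I"
      then have p: "1 \<le> real q" "1 \<le> real a" by (auto simp: I_def)
      have "1 / real q * real (card (A q a)) \<le> 1 / real q * (4 * C * X / (real a * real Q) + 1)"
        using cardA[OF qa] by (intro mult_left_mono) auto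
      also have "\<dots> = 1 / real q + 4 * C * X / real Q * (1 / real q * (1 / real a))"
        by (simp add: divide_inverse algebra_simps)
      finally show "1 / real q * real (card (A q a)) \<le> 1 + 4 * C * X / real Q
        * (1 / real q * (1 / real a))"
        using p by (simp add: field_simps)
    qed
    also have "\<dots> = 2 * real Q ^ 2 + 4 * C * X / real Q * (harm Q * harm (2 * Q))"
    proof -
      have "(\<Sum>(q,a)\<in>I. 1 / real q * (1 / real a)) = harm Q * harm (2 * Q)"
        unfolding I_def harm_def by (simp add: sum_product sum.cartesian_product inverse_eq_divide)
      moreover have "(\<Sum>(q,a)\<in>I. 4 * C * X / real Q * (1 / real q * (1 / real a))) = 4 * C
        * X / real Q * (\<Sum>(q,a)\<in>I. 1 / real q * (1 / real a))"
        by (simp add: case_prod_unfold sum_distrib_left)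
      moreover have "(\<Sum>(q,a)\<in>I. 1 :: real) = 2 * real Q ^ 2"
        by (simp add: I_def case_prod_unfold power2_eq_square)
      ultimately show ?thesis by (simp add: case_prod_unfold sum.distrib)
    qed
    also have "\<dots> \<le> 2 * (X / real Q) + 4 * C * X / real Q * (harm (2 * Q) ^ 2)"
    proof -
      have "real Q ^ 2 \<le> X / real Q" using Q Q0
        by (simp add: field_simps power2_eq_square power3_eq_cube)
      moreover have "harm Q * harm (2 * Q) \<le> (harm (2 * Q) ^ 2 :: real)"
        unfolding power2_eq_square by (intro mult_right_mono harm_mono harm_nonneg) auto
      ultimately show ?thesis using X_pos by (intro add_mono mult_left_mono) (auto simp: C_def)
    qed
    also have "\<dots> = X / real Q * (2 + 20 * real k * harm (2 * Q) ^ 2)"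
      by (simp add: C_def divide_inverse algebra_simps)
    finally show ?thesis by (simp add: mult_left_mono mult.assoc)
  qed
  finally have "\<bar>\<Sum>n=m1..<M. sawtooth (f (real n))\<bar> \<le> 10 * real k * (X / real Q)
    * (2 + 20 * real k * harm (2 * Q) ^ 2) + real Q"
    by simp
  moreover have "real Q \<le> 10 * real k * (X / real Q)"
  proof -
    have "1 * (X / real Q) \<le> 10 * real k * (X / real Q)" using k2 X_pos
      by (intro mult_right_mono) auto
    then show ?thesis using QX by simp
  qed
  moreover have distr: "R * (2 + h) + R = R * (3 + h)" for R h :: real by (simp add: algebra_simps)
  note distr[of "10 * real k * (X / real Q)" "20 * real k * harm (2 * Q) ^ 2"]
  ultimately show ?thesis by linarith
qed

text \<open>
  The three ranges meet at \<open>m0\<close>, about \<open>X powr (1 - 1/k)\<close>, and at \<open>m1\<close>, where the slope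
  reaches \<open>1/Q\<close> with \<open>Q\<close> about \<open>X powr (1/3)\<close>. They contribute, up to constants depending on \<open>k\<close>,
  \<open>X powr (1 - 1/k)\<close>, then \<open>X powr (1 - 1/k) + X/Q\<close>, then \<open>(X/Q) X powr (1/12)\<close>.
\<close>
lemma sum_sawtooth_bound:
  assumes k4: "4 \<le> k"
  shows "\<bar>\<Sum>n=1..<M. sawtooth (f (real n))\<bar> \<le> (20 + 18 * 3 ^ k + 65000 * real k ^ 2)
    * X powr (1 - 1 / real k)"
proof -
  define Z where "Z = X powr (1 - 1 / real k)"
  define Q where "Q = nat \<lfloor>X powr (1/3)\<rfloor>"
  have cube: "1 \<le> X powr (1/3)" using X1 by (intro ge_one_powr_ge_zero) auto
  have Q: "1 \<le> Q" using cube by (simp add: Q_def le_nat_floor)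
  have Q_le: "real Q \<le> X powr (1/3)" using X_pos by (simp add: Q_def of_nat_floor)
  have Q_ge: "X powr (1/3) \<le> 2 * real Q"
  proof -
    have "X powr (1/3) < real Q + 1" unfolding Q_def using cube by linarith
    then show ?thesis using Q by simp
  qed
  have Q3: "real Q ^ 3 \<le> X"
  proof -
    have "real Q ^ 3 \<le> (X powr (1/3)) ^ 3" using Q_le by (intro power_mono) auto
    also have "\<dots> = X" using X_pos by (simp add: powr_realpow[symmetric] powr_powr)
    finally show ?thesis .
  qed
  have Z1: "1 \<le> Z" unfolding Z_def using X1 k4 by (intro ge_one_powr_ge_zero) auto
  have Z34: "X powr (3/4) \<le> Z" unfolding Z_def using X1 k4
    by (intro powr_mono) (auto simp: field_simps)
  have Z23: "X powr (2/3) \<le> Z"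
    using X1 by (intro order_trans[OF _ Z34] powr_mono) auto
  have XQ: "X / real Q \<le> 2 * X powr (2/3)"
  proof -
    have "X = X powr (1/3) * X powr (2/3)" using X_pos by (simp add: powr_add[symmetric])
    also have "\<dots> \<le> 2 * real Q * X powr (2/3)" using Q_ge by (intro mult_right_mono) auto
    finally show ?thesis using Q by (simp add: field_simps)
  qed
  \<comment> \<open>If the slope stays below \<open>1/Q\<close>, the second range extends up to \<open>M\<close>.\<close>
  define m1 where "m1 = (LEAST n. M \<le> n \<or> 1 / real Q \<le> slope (real n))"
  have m1M: "m1 \<le> M" unfolding m1_def by (rule Least_le) simp
  have m1P: "M \<le> m1 \<or> 1 / real Q \<le> slope (real m1)" unfolding m1_def by (rule LeastI[of _ M]) simp
  have small: "slope (real n) \<le> 1 / real Q" if "n < m1" for n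
    using not_less_Least[of n "\<lambda>n. M \<le> n \<or> 1 / real Q \<le> slope (real n)"] that by (auto simp: m1_def)
  have large: "1 / real Q \<le> slope (real n)" if "m1 \<le> n" "n < M" for n
  proof -
    have "slope (real m1) \<le> slope (real n)" using that M_le Y_less by (intro slope_mono) auto
    then show ?thesis using m1P that by auto
  qed
  have L: "\<bar>\<Sum>n=m1..<M. sawtooth (f (real n))\<bar> \<le> 65000 * real k ^ 2 * Z"
  proof -
    have "\<bar>\<Sum>n=m1..<M. sawtooth (f (real n))\<bar> \<le> 10 * real k * (X / real Q)
      * (3 + 20 * real k * harm (2 * Q) ^ 2)"
      by (rule sum_sawtooth_large_slope[OF Q Q3 m1M large]) auto
    also have "\<dots> \<le> 10 * real k * (2 * X powr (2/3))
      * (4 * real k * X powr (1/12) + 20 * real k * (162 * X powr (1/12)))"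
    proof (intro mult_mono add_mono)
      have "1 \<le> X powr (1/12)" using X1 by (intro ge_one_powr_ge_zero) auto
      then have "4 * real 1 * 1 \<le> 4 * real k * X powr (1/12)" using k4 by (intro mult_mono) auto
      then show "3 \<le> 4 * real k * X powr (1/12)" by simp
      have "(harm (2 * Q) :: real) ^ 2 \<le> (9 * real (2 * Q) powr (1/8)) ^ 2"
        using Q by (intro power_mono harm_le_powr harm_nonneg) auto
      also have "\<dots> = 81 * real (2 * Q) powr (1/4)"
        using Q by (simp add: power_mult_distrib powr_realpow[symmetric] powr_powr)
      also have "\<dots> \<le> 81 * (2 * X powr (1/12))"
      proof -
        have "real (2 * Q) powr (1/4) \<le> (2 * X powr (1/3)) powr (1/4)"
          using Q_le by (intro powr_mono2) auto
        also have "\<dots> = 2 powr (1/4) * X powr (1/12)" by (simp add: powr_mult powr_powr)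
        also have "\<dots> \<le> 2 powr 1 * X powr (1/12)" by (intro mult_right_mono powr_mono) auto
        finally show ?thesis by simp
      qed
      finally show "harm (2 * Q) ^ 2 \<le> 162 * X powr (1/12)" by simp
    qed (use XQ X_pos in auto)
    also have "\<dots> = 64880 * real k ^ 2 * (X powr (2/3) * X powr (1/12))"
      by (simp add: power2_eq_square)
    also have "X powr (2/3) * X powr (1/12) = X powr (3/4)" by (simp add: powr_add[symmetric])
    also have "64880 * real k ^ 2 * X powr (3/4) \<le> 65000 * real k ^ 2 * Z" using Z34
      by (intro mult_mono) auto
    finally show ?thesis .
  qed
  define m0 where "m0 = nat \<lceil>Z\<rceil>"
  have m0: "0 < m0" "Z \<le> real m0" "real m0 \<le> 2 * Z" using Z1 unfolding m0_def by linarith+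
  have m0k: "X ^ (k - 1) \<le> real m0 ^ k"
  proof -
    have e: "(1 - 1 / real k) * real k = real (k - 1)" using k4
      by (simp add: field_simps of_nat_diff)
    have "Z ^ k = X powr real (k - 1)"
      unfolding Z_def e[symmetric] using X_pos by (simp add: powr_realpow[symmetric] powr_powr)
    then have "X ^ (k - 1) = Z ^ k" using X_pos by (simp add: powr_realpow)
    also have "\<dots> \<le> real m0 ^ k" using m0 Z1 by (intro power_mono) auto
    finally show ?thesis .
  qed
  have S: "\<bar>\<Sum>n=m0..<m1. sawtooth (f (real n))\<bar> \<le> (9 + 18 * 3 ^ k) * Z"
  proof (cases "m0 \<le> m1")
    case True
    have "\<bar>\<Sum>n=m0..<m1. sawtooth (f (real n))\<bar> \<le> 9/2 * (1 / real Q) * X + (16 * 3 ^ (k - 1) + 2)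
      * (X / real m0) ^ (k - 1)"
      by (rule sum_sawtooth_small_slope[OF m0k m0(1) True m1M small])
    also have "\<dots> \<le> 9 * Z + 18 * 3 ^ k * Z"
    proof (rule add_mono[OF _ mult_mono])
      show "9/2 * (1 / real Q) * X \<le> 9 * Z" using XQ Z23 by simp
      have "(3::real) ^ (k - 1) \<le> 3 ^ k" by (intro power_increasing) auto
      moreover have "(1::real) \<le> 3 ^ k" by simp
      ultimately show "(16 * 3 ^ (k - 1) + 2) \<le> (18 * 3 ^ k :: real)" by linarith
      have "(X / real m0) ^ (k - 1) \<le> (X / Z) ^ (k - 1)"
        using m0 Z1 X_pos by (intro power_mono divide_left_mono) auto
      also have "X / Z = X powr (1 / real k)"
        unfolding Z_def using X_pos by (simp add: powr_diff)
      also have "\<dots> ^ (k - 1) = Z"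
      proof -
        have e: "1 - 1 / real k = 1 / real k * real (k - 1)" using k4
          by (simp add: field_simps of_nat_diff)
        show ?thesis unfolding Z_def e using X_pos by (simp add: powr_realpow[symmetric] powr_powr)
      qed
      finally show "(X / real m0) ^ (k - 1) \<le> Z" .
    qed (use X_pos in auto)
    finally show ?thesis by (simp add: algebra_simps)
  qed (use Z1 in simp)
  have triv: "\<bar>\<Sum>n=1..<m. sawtooth (f (real n))\<bar> \<le> 2 * Z" if "m \<le> m0" for m
  proof -
    have "\<bar>\<Sum>n=1..<m. sawtooth (f (real n))\<bar> \<le> (\<Sum>n=1..<m. \<bar>sawtooth (f (real n))\<bar>)" by (rule sum_abs)
    also have "\<dots> \<le> (\<Sum>n=1..<m. 1)" by (intro sum_mono order_trans[OF abs_sawtooth_le]) auto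
    also have "\<dots> \<le> real m0" using that by simp
    finally show ?thesis using m0 by simp
  qed
  have head: "\<bar>\<Sum>n=1..<m1. sawtooth (f (real n))\<bar> \<le> 2 * Z + (9 + 18 * 3 ^ k) * Z"
  proof (cases "m0 \<le> m1")
    case True
    have "(\<Sum>n=1..<m1. sawtooth (f (real n))) = (\<Sum>n=1..<m0. sawtooth (f (real n)))
      + (\<Sum>n=m0..<m1. sawtooth (f (real n)))"
      using True m0 by (simp add: sum.atLeastLessThan_concat)
    then show ?thesis using triv[of m0] S by linarith
  next
    case False
    have "0 \<le> (9 + 18 * 3 ^ k) * Z" using Z1 by simp
    then show ?thesis using triv[of m1] False by linarith
  qed
  have "\<bar>\<Sum>n=1..<M. sawtooth (f (real n))\<bar> \<le> 2 * Z + (9 + 18 * 3 ^ k) * Z + 65000 * real k ^ 2 * Z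
    + 2 * Z"
  proof (cases "1 \<le> m1")
    case True
    have "(\<Sum>n=1..<M. sawtooth (f (real n))) = (\<Sum>n=1..<m1. sawtooth (f (real n)))
      + (\<Sum>n=m1..<M. sawtooth (f (real n)))"
      using True m1M by (simp add: sum.atLeastLessThan_concat)
    then show ?thesis using head L Z1 by linarith
  next
    case False
    then have m10: "m1 = 0" by simp
    have "slope (real 0) = 0" using k4 by (simp add: slope_def)
    then have "M = 0" using m1P m10 Q by auto
    then show ?thesis using Z1 by simp
  qed
  also have "\<dots> \<le> (20 + 18 * 3 ^ k + 65000 * real k ^ 2) * Z" using Z1 by (simp add: algebra_simps)
  finally show ?thesis by (simp add: Z_def)
qed

end

section \<open>The trapezoid rule for concave functions\<close>

lemma integral_affine_unit:
  fixes A B u :: real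
  shows "((\<lambda>t. A + B * (t - u)) has_integral (A + B / 2)) {u..u + 1}"
proof -
  have "((\<lambda>t. A + B * (t - u)) has_integral ((\<lambda>t. A * t + B * (t - u) ^ 2 / 2) (u + 1)
    - (\<lambda>t. A * t + B * (t - u) ^ 2 / 2) u)) {u..u + 1}"
    by (rule fundamental_theorem_of_calculus)
      (auto intro!: derivative_eq_intros simp:
        has_real_derivative_iff_has_vector_derivative[symmetric])
  then show ?thesis by (simp add: algebra_simps)
qed

lemma concave_above_chord:
  fixes g :: "real \<Rightarrow> real"
  assumes "concave_on S g" "u \<in> S" "v \<in> S" "u < v" "u \<le> t" "t \<le> v"
  shows "g u + (g v - g u) / (v - u) * (t - u) \<le> g t"
proof -
  define l where "l = (t - u) / (v - u)"
  have l: "0 \<le> l" "l \<le> 1" using assms by (auto simp: l_def)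
  have t: "t = (1 - l) *\<^sub>R u + l *\<^sub>R v"
  proof -
    have "l * (v - u) = t - u" using assms by (simp add: l_def)
    then show ?thesis by (simp add: algebra_simps)
  qed
  have "(1 - l) * g u + l * g v \<le> g t"
    unfolding t using assms l by (intro concave_onD[OF assms(1)]) auto
  moreover have "l * (g v - g u) = (g v - g u) / (v - u) * (t - u)" by (simp add: l_def)
  ultimately show ?thesis by (simp add: algebra_simps)
qed

text \<open>
  On \<open>{i..i + 1}\<close> a concave function lies above its chord and below the continuation of the
  chord over \<open>{i - 1..i}\<close>, and the areas under these two lines differ by half a second difference.
  The second differences telescope. On the first interval the constant \<open>g 0\<close> serves as upper line.
    In this
  form the bound involves no derivative, so it also applies when the graph of \<open>g\<close> ends with a
  vertical tangent.
\<close>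
lemma trapezoid_concave_antimono:
  fixes g :: "real \<Rightarrow> real"
  assumes conc: "concave_on {0..b} g" and cont: "continuous_on {0..b} g"
    and anti: "\<And>s t. 0 \<le> s \<Longrightarrow> s \<le> t \<Longrightarrow> t \<le> b \<Longrightarrow> g t \<le> g s"
    and M: "real M \<le> b" "0 < M"
  shows "\<bar>(\<Sum>m=1..M. g (real m)) - (integral {0..real M} g - g 0 / 2 + g (real M) / 2)\<bar>
    \<le> (g (real (M - 1)) - g (real M)) / 2"
proof -
  have int: "g integrable_on {u..v}" if "0 \<le> u" "v \<le> b" for u v
    using that by (intro integrable_continuous_real continuous_on_subset[OF cont]) auto
  have lower: "(g (real i) + g (real (Suc i))) / 2 \<le> integral {real i..real i + 1} g"
    if "i < M" for i
  proof -
    have "g (real i) + (g (real (Suc i)) - g (real i)) / 2 \<le> integral {real i..real i + 1} g"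
    proof (rule has_integral_le[OF integral_affine_unit integrable_integral])
      show "g integrable_on {real i..real i + 1}" using that M by (intro int) auto
      fix t assume "t \<in> {real i..real i + 1}"
      then show "g (real i) + (g (real (Suc i)) - g (real i)) * (t - real i) \<le> g t"
        using concave_above_chord[OF conc, of "real i" "real (Suc i)" t] that M by auto
    qed
    then show ?thesis by (simp add: field_simps)
  qed
  \<comment> \<open>The slope of the upper line on \<open>{i..i + 1}\<close>.\<close>
  define d where "d i = (if i = 0 then 0 else g (real i) - g (real (i - 1)))" for i :: nat
  have upper: "integral {real i..real i + 1} g \<le> g (real i) + d i / 2" if "i < M" for i
  proof -
    have "integral {real i..real i + 1} g \<le> g (real i) + d i / 2"
    proof (rule has_integral_le[OF integrable_integral integral_affine_unit])
      show "g integrable_on {real i..real i + 1}" using that M by (intro int) auto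
      fix t assume t: "t \<in> {real i..real i + 1}"
      show "g t \<le> g (real i) + d i * (t - real i)"
      proof (cases "i = 0")
        case True then show ?thesis using t anti[of 0 t] M by (auto simp: d_def)
      next
        case False
        define u where "u = real (i - 1)"
        have u: "real i = u + 1" "0 \<le> u" using False by (auto simp: u_def of_nat_diff)
        have tb: "t \<le> b" "u + 1 \<le> t" using t that M u by auto
        have "g u + (g t - g u) / (t - u) * (real i - u) \<le> g (real i)"
          using tb u by (intro concave_above_chord[OF conc]) auto
        then have "(g t - g u) / (t - u) \<le> g (real i) - g u" using u by simp
        then have "g t - g u \<le> (g (real i) - g u) * (t - u)" using tb by (simp add: field_simps)
        then show ?thesis using False u by (simp add: d_def u_def[symmetric] algebra_simps)
      qed
    qed
    then show ?thesis .
  qed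
  have split: "integral {0..real N} g = (\<Sum>i<N. integral {real i..real i + 1} g)" if "N \<le> M" for N
    using that
  proof (induction N)
    case (Suc N)
    have "integral {0..real N} g + integral {real N..real (Suc N)} g = integral {0..real (Suc N)} g"
      using Suc.prems M by (intro Henstock_Kurzweil_Integration.integral_combine int) auto
    then show ?case using Suc by (simp add: add.commute)
  qed simp
  have shift: "(\<Sum>m=1..M. g (real m)) = (\<Sum>i<M. g (real i)) - g 0 + g (real M)"
    using M(2) sum.atLeast_Suc_atMost[of 0 M "\<lambda>i. g (real i)"] sum.lessThan_Suc_shift
    by (simp add: lessThan_Suc_atMost[symmetric] atLeast0AtMost)
  have shift': "(\<Sum>i<M. g (real (Suc i))) = (\<Sum>i<M. g (real i)) - g 0 + g (real M)"
    by (induction M) auto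
  have "(\<Sum>i<M. (g (real i) + g (real (Suc i))) / 2) \<le> integral {0..real M} g"
    unfolding split[OF order_refl] by (intro sum_mono lower) auto
  moreover have "(\<Sum>i<M. (g (real i) + g (real (Suc i))) / 2) = (\<Sum>i<M. g (real i)) - g 0 / 2
    + g (real M) / 2"
    unfolding sum_divide_distrib[symmetric] sum.distrib shift' by (simp add: field_simps)
  moreover have "integral {0..real M} g \<le> (\<Sum>i<M. g (real i) + d i / 2)"
    unfolding split[OF order_refl] by (intro sum_mono upper) auto
  moreover have "(\<Sum>i<M. d i) = g (real (M - 1)) - g 0"
    using M(2)
  proof (induction M rule: nat_induct_non_zero)
    case 1 then show ?case by (simp add: d_def)
  next
    case (Suc n) then show ?case by (simp add: d_def)
  qed
  then have "(\<Sum>i<M. g (real i) + d i / 2) = (\<Sum>i<M. g (real i)) + (g (real (M - 1)) - g 0) / 2"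
    by (simp add: sum.distrib sum_divide_distrib[symmetric])
  ultimately show ?thesis unfolding shift by (simp add: abs_le_iff field_simps)
qed

text \<open>
  The tangent at an interior point \<open>z > 0\<close> lies above the graph by the weighted
  inequality between the arithmetic and the geometric mean; working with tangents at \<open>z\<close> covers the
  endpoint 0, where the derivative is infinite for \<open>p < 1\<close>.
\<close>
lemma concave_on_powr:
  assumes "0 < p" "p \<le> 1"
  shows "concave_on {0..} (\<lambda>x::real. x powr p)"
proof (rule concave_on_linorderI)
  fix t x y :: real
  assume t: "0 < t" "t < 1" and xy: "x \<in> {0..}" "y \<in> {0..}" "x < y"
  define z where "z = (1 - t) * x + t * y"
  have z: "0 < z" using t xy by (auto simp: z_def intro!: add_nonneg_pos mult_pos_pos)
  have tangent: "u powr p \<le> z powr p + p * z powr (p - 1) * (u - z)" if "0 \<le> u" for u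
  proof -
    have "(u / z) powr p \<le> 1 + p * (u / z - 1)"
    proof (cases "u = 0")
      case False
      then have "(u / z) powr p * 1 powr (1 - p) \<le> p * (u / z) + (1 - p) * 1"
        using assms that z by (intro Youngs_inequality_0) auto
      then show ?thesis by (simp add: algebra_simps)
    qed (use assms in auto)
    then have "z powr p * (u / z) powr p \<le> z powr p * (1 + p * (u / z - 1))"
      by (intro mult_left_mono) auto
    moreover have "z powr p * (u / z) powr p = u powr p" using z that by (simp add: powr_divide)
    moreover have "z powr p = z powr (p - 1) * z" using z by (simp add: powr_diff)
    then have "z powr p * (1 + p * (u / z - 1)) = z powr p + p * z powr (p - 1) * (u - z)"
      using z by (simp add: field_simps)
    ultimately show ?thesis by simp
  qed
  have "(1 - t) * x powr p + t * y powr p \<le> (1 - t) * (z powr p + p * z powr (p - 1) * (x - z))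
    + t * (z powr p + p * z powr (p - 1) * (y - z))"
    using t xy by (intro add_mono mult_left_mono tangent) auto
  also have "\<dots> = z powr p" by (simp add: z_def algebra_simps)
  finally show "(1 - t) * x powr p + t * y powr p \<le> ((1 - t) *\<^sub>R x + t *\<^sub>R y) powr p"
    by (simp add: z_def)
qed (simp add: convex_real_interval)

lemma concave_on_lame:
  fixes X :: real
  assumes "0 < p" "p \<le> 1" "1 \<le> k" "0 \<le> X"
  shows "concave_on {0..X} (\<lambda>t. (X ^ k - t ^ k) powr p)"
proof (rule concave_on_linorderI)
  fix t x y :: real
  assume t: "0 < t" "t < 1" and xy: "x \<in> {0..X}" "y \<in> {0..X}" "x < y"
  define z where "z = (1 - t) * x + t * y"
  have conv: "z ^ k \<le> (1 - t) * x ^ k + t * y ^ k"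
  proof -
    have "convex_on {0..} (\<lambda>x::real. x ^ k)"
      using convex_power_odd[of k] convex_on_subset[OF convex_power_even[of k]]
      by (cases "even k") auto
    from convex_onD[OF this, of t x y] show ?thesis using t xy by (simp add: z_def)
  qed
  have le: "x ^ k \<le> X ^ k" "y ^ k \<le> X ^ k" using xy by (auto intro!: power_mono)
  have "(1 - t) * (X ^ k - x ^ k) powr p + t * (X ^ k - y ^ k) powr p
     \<le> ((1 - t) * (X ^ k - x ^ k) + t * (X ^ k - y ^ k)) powr p"
    using concave_onD[OF concave_on_powr[OF assms(1,2)], of t "X ^ k - x ^ k" "X ^ k - y ^ k"] t
      le by simp
  also have "\<dots> \<le> (X ^ k - z ^ k) powr p"
  proof (rule powr_mono2)
    show "0 \<le> (1 - t) * (X ^ k - x ^ k) + t * (X ^ k - y ^ k)"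
      using t le by (intro add_nonneg_nonneg mult_nonneg_nonneg) auto
  qed (use assms conv in \<open>auto simp: algebra_simps\<close>)
  finally show "(1 - t) * (X ^ k - x ^ k) powr p + t * (X ^ k - y ^ k) powr p
     \<le> (X ^ k - ((1 - t) *\<^sub>R x + t *\<^sub>R y) ^ k) powr p" by (simp add: z_def)
qed (simp add: convex_real_interval)

section \<open>Lame integrals and power sums along the Lame curve\<close>

definition lame_integral :: "nat \<Rightarrow> real \<Rightarrow> real" where
  "lame_integral k p = integral {0..1} (\<lambda>t. (1 - t ^ k) powr p)"

lemma continuous_on_lame:
  fixes X :: real
  assumes "0 < p"
  shows "continuous_on {0..X} (\<lambda>t. (X ^ k - t ^ k) powr p)"
  using assms by (intro continuous_on_powr' continuous_intros) (auto intro: power_mono)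

text \<open>
  The substitution \<open>u = t ^ k\<close> leads to the Beta integral. Its integrand may be unbounded at 0,
  so the substitution is carried out by differentiating \<open>integral {0..u powr (1/k)}\<close> inside the
  open unit interval.
\<close>
lemma lame_integral_eq_Gamma:
  assumes "0 < p" "0 < k"
  shows "lame_integral k p = Gamma (1 + 1 / real k) * Gamma (1 + p) / Gamma (1 + p + 1 / real k)"
proof -
  define \<phi> where "\<phi> t = (1 - t ^ k) powr p" for t :: real
  have cont: "continuous_on {0..1} \<phi>" unfolding \<phi>_def
    using continuous_on_lame[OF assms(1), of 1 k] by simp
  define H where "H u = integral {0..u powr (1 / real k)} \<phi>" for u
  have pw: "u powr (1 / real k) \<in> {0..1}" if "u \<in> {0..1}" for u :: real
    using that powr_mono2[of "1 / real k" u 1] by auto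
  have "((\<lambda>u. (1 - u) powr p * (1 / real k * u powr (1 / real k - 1))) has_integral H 1
    - H 0) {0..1}"
  proof (rule fundamental_theorem_of_calculus_interior)
    have "continuous_on {0..1} (\<lambda>x. integral {0..x} \<phi>)"
      by (intro indefinite_integral_continuous_1 integrable_continuous_real cont)
    moreover have "continuous_on {0..1} (\<lambda>u::real. u powr (1 / real k))"
      using assms by (intro continuous_on_powr' continuous_intros) auto
    ultimately show "continuous_on {0..1} H"
      unfolding H_def by (rule continuous_on_compose2) (use pw in blast)
    fix u :: real assume u: "u \<in> {0<..<1}"
    define v where "v = u powr (1 / real k)"
    have v: "v \<in> {0<..<1}" using u assms powr_less_mono2[of "1 / real k" u 1] by (auto simp: v_def)
    have "((\<lambda>x. integral {0..x} \<phi>) has_real_derivative \<phi> v) (at v within {0..1})"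
      using v by (intro integral_has_real_derivative cont) auto
    then have "((\<lambda>x. integral {0..x} \<phi>) has_real_derivative \<phi> v) (at v)"
      using v by (simp add: at_within_Icc_at)
    moreover have "((\<lambda>u. u powr (1 / real k)) has_real_derivative 1 / real k
      * u powr (1 / real k - 1)) (at u)"
      using u by (auto intro!: derivative_eq_intros)
    ultimately have "(H has_real_derivative \<phi> v * (1 / real k * u powr (1 / real k - 1))) (at u)"
      unfolding H_def v_def by (rule DERIV_chain2)
    moreover have "v ^ k = u"
      using v u assms by (simp add: v_def powr_realpow[symmetric] powr_powr)
    ultimately show "(H has_vector_derivative (1 - u) powr p
      * (1 / real k * u powr (1 / real k - 1))) (at u)"
      by (simp add: \<phi>_def has_real_derivative_iff_has_vector_derivative)
  qed simp
  moreover have "((\<lambda>u. 1 / real k * (u powr (1 / real k - 1) * (1 - u) powr (p + 1 - 1)))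
    has_integral 1 / real k * Beta (1 / real k) (p + 1)) {0..1}"
    using assms by (intro has_integral_mult_right has_integral_Beta_real) auto
  ultimately have "H 1 - H 0 = 1 / real k * Beta (1 / real k) (p + 1)"
    by (intro has_integral_unique) (auto simp: mult_ac)
  moreover have "H 1 - H 0 = lame_integral k p"
    by (simp add: H_def lame_integral_def \<phi>_def[abs_def])
  moreover have "Gamma (1 / real k + 1) = 1 / real k * Gamma (1 / real k)"
    using assms by (intro Gamma_plus1) auto
  ultimately show ?thesis by (simp add: Beta_def algebra_simps)
qed

lemma integral_lame_scale:
  fixes X :: real
  assumes "0 < p" "0 < X" and that: "0 \<le> b" "b \<le> 1"
  shows "integral {0..X * b} (\<lambda>t. (X ^ k - t ^ k) powr p) = X powr (real k * p + 1)
    * integral {0..b} (\<lambda>t. (1 - t ^ k) powr p)"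
proof -
  have "((\<lambda>t. X *\<^sub>R (\<lambda>t. (X ^ k - t ^ k) powr p) (X * t))
    has_integral integral {X * 0..X * b} (\<lambda>t. (X ^ k - t ^ k) powr p)) {0..b}"
    using assms that
    by (intro has_integral_substitution[where c = 0 and d = X] continuous_on_lame)
      (auto intro!: derivative_eq_intros mult_left_le)
  moreover have "X *\<^sub>R (\<lambda>t. (X ^ k - t ^ k) powr p) (X * t) = X powr (real k * p + 1)
    * (1 - t ^ k) powr p"
    if "t \<in> {0..b}" for t
  proof -
    have "t ^ k \<le> 1" using that \<open>b \<le> 1\<close> by (intro power_le_one) auto
    have "X ^ k - (X * t) ^ k = X ^ k * (1 - t ^ k)" by (simp add: power_mult_distrib algebra_simps)
    then show ?thesis using \<open>t ^ k \<le> 1\<close> assms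
      by (simp add: powr_mult powr_add powr_powr powr_realpow[symmetric])
  qed
  ultimately have "((\<lambda>t. X powr (real k * p + 1) * (1 - t ^ k) powr p)
    has_integral integral {0..X * b} (\<lambda>t. (X ^ k - t ^ k) powr p)) {0..b}"
    by (subst has_integral_cong[symmetric]) auto
  moreover have "((\<lambda>t. X powr (real k * p + 1) * (1 - t ^ k) powr p)
    has_integral X powr (real k * p + 1) * integral {0..b} (\<lambda>t. (1 - t ^ k) powr p)) {0..b}"
    using continuous_on_lame[OF assms(1), of 1 k] that
    by (intro has_integral_mult_right integrable_integral integrable_continuous_real)
       (auto intro: continuous_on_subset)
  ultimately show ?thesis by (rule has_integral_unique)
qed

lemma power_diff_le:
  fixes a X :: real
  assumes "0 \<le> a" "0 < X"
  shows "X ^ k - a ^ k \<le> real k * X powr (real k - 1) * (X - a)"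
proof -
  have "1 + real k * (a / X - 1) \<le> (1 + (a / X - 1)) ^ k"
    using assms by (intro Bernoulli_inequality) auto
  then have "X ^ k * (1 + real k * (a / X - 1)) \<le> X ^ k * (a / X) ^ k"
    using assms by (intro mult_left_mono) auto
  moreover have "X ^ k * (a / X) ^ k = a ^ k" using assms by (simp add: power_divide)
  moreover have "X ^ k = X * X powr (real k - 1)" using assms by (simp add: powr_diff powr_realpow)
  then have "X ^ k * (1 + real k * (a / X - 1)) = X ^ k + real k * X powr (real k - 1) * (a - X)"
    using assms by (simp add: field_simps)
  ultimately show ?thesis by (simp add: algebra_simps)
qed

text \<open>
  By the trapezoid rule the error is governed by the last values of the summand, at arguments
  within 2 of \<open>X\<close>. There \<open>X ^ k - t ^ k = O(X ^ (k - 1))\<close>, and its power \<open>p\<close> is of the order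
  \<open>X powr ((k - 1) * p) = x powr (p - p/k)\<close>.
\<close>
lemma sum_lame_powr:
  fixes x p :: real
  assumes k: "2 \<le> k" and p: "0 < p" "p \<le> 1" and x: "1 \<le> x"
  shows "\<bar>(\<Sum>m=1..nat \<lfloor>x powr (1 / real k)\<rfloor>. (x - real m ^ k) powr p)
           - (lame_integral k p * x powr (p + 1 / real k) - x powr p / 2)\<bar> \<le> 4 * real k * x powr
             (p - p / real k)"
proof -
  define X where "X = x powr (1 / real k)"
  have X1: "1 \<le> X" unfolding X_def using x by (intro ge_one_powr_ge_zero) auto
  have Xk: "X ^ k = x" using x k by (simp add: X_def powr_realpow[symmetric] powr_powr)
  define M where "M = nat \<lfloor>X\<rfloor>"
  have M: "0 < M" "real M \<le> X" "X < real M + 1" unfolding M_def using X1 by linarith+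
  define g where "g t = (X ^ k - t ^ k) powr p" for t
  have anti: "g t \<le> g s" if "0 \<le> s" "s \<le> t" "t \<le> X" for s t
    unfolding g_def using that p by (intro powr_mono2) (auto intro: power_mono)
  have cont: "continuous_on {0..X} g" unfolding g_def by (rule continuous_on_lame[OF p(1)])
  have conc: "concave_on {0..X} g" unfolding g_def using p k X1 by (intro concave_on_lame) auto
  have trap: "\<bar>(\<Sum>m=1..M. g (real m)) - (integral {0..real M} g - g 0 / 2 + g (real M) / 2)\<bar>
    \<le> (g (real (M - 1)) - g (real M)) / 2"
    by (rule trapezoid_concave_antimono[OF conc cont anti M(2,1)])
  have gn: "0 \<le> g t" for t by (simp add: g_def)
  have int: "g integrable_on {u..v}" if "0 \<le> u" "v \<le> X" for u v
    using that by (intro integrable_continuous_real continuous_on_subset[OF cont]) auto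
  have "integral {real M..X} g \<le> integral {real M..X} (\<lambda>_. g (real M))"
    using M by (intro integral_le int) (auto intro: anti)
  also have "\<dots> \<le> g (real M)" using M gn by (simp add: mult_left_le_one_le)
  finally have tail: "integral {real M..X} g \<le> g (real M)" .
  have tail0: "0 \<le> integral {real M..X} g" using M by (intro integral_nonneg int gn) auto
  have comb: "integral {0..real M} g + integral {real M..X} g = integral {0..X} g"
    using M by (intro Henstock_Kurzweil_Integration.integral_combine int) auto
  have gM: "g (real M) \<le> g (real (M - 1))" using M by (intro anti) auto
  have last: "g (real (M - 1)) \<le> 2 * real k * x powr (p - p / real k)"
  proof -
    have "X ^ k - real (M - 1) ^ k \<le> real k * X powr (real k - 1) * (X - real (M - 1))"
      using X1 by (intro power_diff_le) auto
    also have "\<dots> \<le> real k * X powr (real k - 1) * 2"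
      using M by (intro mult_left_mono) auto
    finally have "g (real (M - 1)) \<le> (2 * real k * X powr (real k - 1)) powr p"
      unfolding g_def using M p by (intro powr_mono2) (auto intro!: power_mono simp: mult_ac)
    also have "\<dots> = (2 * real k) powr p * X powr ((real k - 1) * p)"
      by (simp add: powr_mult powr_powr)
    also have "\<dots> \<le> (2 * real k) powr 1 * X powr ((real k - 1) * p)"
      using k p by (intro mult_right_mono powr_mono) auto
    also have "X powr ((real k - 1) * p) = x powr (p - p / real k)"
    proof -
      have "1 / real k * ((real k - 1) * p) = p - p / real k" using k by (simp add: field_simps)
      then show ?thesis unfolding X_def powr_powr by simp
    qed
    finally show ?thesis by simp
  qed
  have g0: "g 0 = x powr p" using k by (simp add: g_def Xk power_0_left)
  have IX: "integral {0..X} g = lame_integral k p * x powr (p + 1 / real k)"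
  proof -
    have "integral {0..X} g = X powr (real k * p + 1) * lame_integral k p"
      using integral_lame_scale[of p X 1 k] p X1 by (simp add: g_def[abs_def] lame_integral_def)
    also have "X powr (real k * p + 1) = x powr (p + 1 / real k)"
      using k by (simp add: X_def powr_powr field_simps)
    finally show ?thesis by simp
  qed
  have "(\<Sum>m=1..nat \<lfloor>x powr (1 / real k)\<rfloor>. (x - real m ^ k) powr p) = (\<Sum>m=1..M. g (real m))"
    by (simp add: M_def X_def[symmetric] g_def Xk)
  moreover have "\<bar>(\<Sum>m=1..M. g (real m)) - (integral {0..X} g - g 0 / 2)\<bar> \<le> 2 * g (real (M - 1))"
    using trap tail tail0 comb gM gn[of "real M"] unfolding abs_le_iff by argo
  ultimately show ?thesis using last by (simp add: g0 IX)
qed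

section \<open>Lattice points under the Lame curve\<close>

text \<open>
  The region under the unit curve consists of two mirror images overlapping in the square of side
  \<open>c\<close>, where \<open>(c, c)\<close> lies on the diagonal. The analytic form of this reflection is that
  \<open>I u + I (\<phi> u) - u * \<phi> u\<close> is constant, because \<open>\<phi>\<close> is its own inverse.
\<close>
lemma lame_integral_symmetric:
  assumes k: "2 \<le> k"
  defines "c \<equiv> 1 / 2 powr (1 / real k)"
  shows "lame_integral k (1 / real k) = 2 * integral {0..c} (\<lambda>t. (1 - t ^ k) powr (1 / real k))
    - c ^ 2"
proof -
  define \<phi> where "\<phi> t = (1 - t ^ k) powr (1 / real k)" for t :: real
  interpret L: lame_curve k 1 using k by unfold_locales auto
  have phi: "\<phi> t = L.f t" for t by (simp add: \<phi>_def L.f_def)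
  have cY: "c = L.Y" by (simp add: c_def L.Y_def)
  have c: "0 < c" "c < 1" using L.Y_pos L.Y_less by (simp_all add: cY)
  have cont: "continuous_on {0..1} \<phi>"
    unfolding \<phi>_def using continuous_on_lame[of "1 / real k" 1 k] k by simp
  have rng: "\<phi> t \<in> {0..1}" if "t \<in> {0..1}" for t
    using that L.f_le[of t] by (auto simp: phi L.f_def)
  have inv: "\<phi> (\<phi> t) = t" if "0 < t" "t < 1" for t
  proof -
    have "\<phi> t ^ k = 1 - t ^ k" using that L.f_power[of t] by (simp add: phi)
    then have "\<phi> (\<phi> t) = (t ^ k) powr (1 / real k)" by (simp add: \<phi>_def)
    then show ?thesis using that k by (simp add: powr_realpow[symmetric] powr_powr)
  qed
  define I where "I u = integral {0..u} \<phi>" for u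
  have contI: "continuous_on {0..1} I"
    unfolding I_def by (intro indefinite_integral_continuous_1 integrable_continuous_real cont)
  have dI: "(I has_real_derivative \<phi> u) (at u)" if "0 < u" "u < 1" for u
  proof -
    have "(I has_real_derivative \<phi> u) (at u within {0..1})"
      unfolding I_def using that by (intro integral_has_real_derivative cont) auto
    then show ?thesis using that by (simp add: at_within_Icc_at)
  qed
  define G where "G u = I u + I (\<phi> u) - u * \<phi> u" for u
  have "G c = G 0"
  proof (rule DERIV_isconst_end[where f = G])
    show "0 < c" by (rule c)
    show "continuous_on {0..c} G" unfolding G_def
      by (intro continuous_intros continuous_on_subset[OF contI] continuous_on_subset[OF cont]
          continuous_on_compose2[OF contI, of _ \<phi>]) (use c rng in auto)
    fix u assume u: "0 < u" "u < c"
    then have u1: "u < 1" using c by simp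
    have d: "(\<phi> has_real_derivative - L.slope u) (at u)"
      using L.f_has_derivative[of u] u u1 unfolding phi[abs_def] by simp
    have pu: "0 < \<phi> u" "\<phi> u < 1"
    proof -
      show "0 < \<phi> u" using L.f_pos[of u] u u1 by (simp add: phi)
      have "\<phi> u \<le> 1" "\<phi> u \<noteq> 1" using rng[of u] inv[of u] u u1 k by (auto simp: \<phi>_def)
      then show "\<phi> u < 1" by simp
    qed
    have "((\<lambda>u. I (\<phi> u)) has_real_derivative \<phi> (\<phi> u) * (- L.slope u)) (at u)"
      by (rule DERIV_chain2[OF dI[OF pu] d])
    then have "(G has_real_derivative \<phi> u + \<phi> (\<phi> u) * (- L.slope u)
      - (u * (- L.slope u) + 1 * \<phi> u)) (at u)"
      unfolding G_def using u u1
      by (auto intro!: derivative_eq_intros dI d)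
    then show "(G has_real_derivative 0) (at u)" using inv[OF u(1) u1] by simp
  qed
  moreover have "G 0 = lame_integral k (1 / real k)"
    using k by (simp add: G_def I_def lame_integral_def \<phi>_def[abs_def] power_0_left)
  moreover have "G c = 2 * I c - c ^ 2" using L.f_Y by (simp add: G_def phi cY power2_eq_square)
  ultimately show ?thesis by (simp add: I_def \<phi>_def[abs_def])
qed

context lame_curve begin

text \<open>
  Twice the sum minus \<open>M\<^sup>2\<close> is the number of lattice points under the whole curve, since the
  square of side \<open>M\<close> is common to the two halves exchanged by reflection. The floor equals
  the value minus \<open>1/2\<close> minus the sawtooth, and the trapezoid rule evaluates the sum of the
  values up to \<open>O(1)\<close>. What comes from replacing \<open>Y\<close> by its integer part \<open>M\<close> combines to
  \<open>O(1)\<close>: with \<open>e = Y - M\<close> it is \<open>e - e\<^sup>2\<close> plus bounded terms.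
\<close>
lemma sum_floor_f:
  assumes k4: "4 \<le> k"
  shows "\<bar>2 * (\<Sum>m=1..M. of_int \<lfloor>f (real m)\<rfloor>) - real M ^ 2
    - (lame_integral k (1 / real k) * X ^ 2 - X)\<bar>
     \<le> (50 + 36 * 3 ^ k + 130000 * real k ^ 2) * X powr (1 - 1 / real k)"
proof -
  define Z where "Z = X powr (1 - 1 / real k)"
  have Z1: "1 \<le> Z" unfolding Z_def using X1 k4 by (intro ge_one_powr_ge_zero) auto
  define B where "B = (20 + 18 * 3 ^ k + 65000 * real k ^ 2) * Z"
  have B20: "20 * Z \<le> B" unfolding B_def using Z1 by (intro mult_right_mono) auto
  define J where "J = integral {0..real M} f"
  have M: "real M \<le> Y" "Y < real M + 1" using M_le Y_pos unfolding M_def by linarith+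
  have S0: "\<bar>\<Sum>m=1..M. sawtooth (f (real m))\<bar> \<le> B + 1"
  proof (cases "M = 0")
    case True then show ?thesis using B20 Z1 by simp
  next
    case False
    then have "(\<Sum>m=1..M. sawtooth (f (real m))) = (\<Sum>m=1..<M. sawtooth (f (real m)))
      + sawtooth (f (real M))"
      by (metis One_nat_def Suc_leI add.commute not_gr_zero sum.last_plus)
    then show ?thesis using sum_sawtooth_bound[OF k4] abs_sawtooth_le[of "f (real M)"]
      unfolding B_def Z_def by linarith
  qed
  have cont: "continuous_on {0..X} f"
    using continuous_on_lame[of "1 / real k" X k] k4 by (simp add: f_def[abs_def])
  have int: "f integrable_on {u..v}" if "0 \<le> u" "v \<le> X" for u v
    using that by (intro integrable_continuous_real continuous_on_subset[OF cont]) auto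
  have step: "f s - f t \<le> t - s" if st: "0 \<le> s" "s \<le> t" "t \<le> Y" for s t
  proof (cases "s = t")
    case False
    then obtain \<xi> where xi: "\<xi> \<le> slope t" "f t = f s - (t - s) * \<xi>"
      using f_increment[of s t] st Y_less by auto
    have "(t - s) * \<xi> \<le> (t - s) * 1" using xi slope_le_1[of t] that by (intro mult_left_mono) auto
    then show ?thesis using xi by simp
  qed simp
  have f0: "f 0 = X" using k_pos X_pos by
    (simp add: f_def power_0_left powr_realpow[symmetric] powr_powr)
  have fM: "Y \<le> f (real M)" "f (real M) \<le> Y + 1"
    using Y_le_f[of "real M"] step[of "real M" Y] M f_Y by auto
  have trap: "\<bar>(\<Sum>m=1..M. f (real m)) - (J - f 0 / 2 + f (real M) / 2)\<bar> \<le> 1 / 2"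
  proof (cases "M = 0")
    case True then show ?thesis by (simp add: J_def)
  next
    case False
    have "\<bar>(\<Sum>m=1..M. f (real m)) - (J - f 0 / 2 + f (real M) / 2)\<bar>
      \<le> (f (real (M - 1)) - f (real M)) / 2"
      unfolding J_def
    proof (rule trapezoid_concave_antimono)
      show "concave_on {0..X} f" unfolding f_def[abs_def] using k4 X_pos
        by (intro concave_on_lame) auto
    qed (use cont M Y_less False in \<open>auto intro: f_antimono\<close>)
    moreover have "f (real (M - 1)) - f (real M) \<le> 1"
      using step[of "real (M - 1)" "real M"] M False by (simp add: of_nat_diff)
    ultimately show ?thesis by argo
  qed
  have area: "lame_integral k (1 / real k) * X ^ 2 = 2 * integral {0..Y} f - Y ^ 2"
  proof -
    define c where "c = 1 / 2 powr (1 / real k)"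
    have Yc: "Y = X * c" by (simp add: Y_def c_def)
    have c: "0 \<le> c" "c \<le> 1" by (auto simp: c_def ge_one_powr_ge_zero)
    have "integral {0..Y} f = X powr (real k * (1 / real k) + 1)
      * integral {0..c} (\<lambda>t. (1 - t ^ k) powr (1 / real k))"
      unfolding Yc f_def[abs_def] using k4 X_pos c by (intro integral_lame_scale) auto
    also have "X powr (real k * (1 / real k) + 1) = X ^ 2" using k4 X_pos by simp
    finally show ?thesis
      using lame_integral_symmetric[OF k2, folded c_def]
      by (simp add: Yc left_diff_distrib right_diff_distrib power_mult_distrib mult_ac)
  qed
  have last: "\<bar>integral {0..Y} f - J - (Y - real M) * Y\<bar> \<le> 1"
  proof -
    have "J + integral {real M..Y} f = integral {0..Y} f"
      unfolding J_def using M Y_less by (intro Henstock_Kurzweil_Integration.integral_combine int)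
        auto
    moreover have "integral {real M..Y} (\<lambda>_. Y) \<le> integral {real M..Y} f"
      using M Y_less Y_le_f by (intro integral_le int) auto
    moreover have "integral {real M..Y} f \<le> integral {real M..Y} (\<lambda>_. Y + 1)"
    proof (intro integral_le int)
      fix t assume "t \<in> {real M..Y}"
      then have "f t \<le> f (real M)" using Y_less by (intro f_antimono) auto
      then show "f t \<le> Y + 1" using fM by simp
    qed (use M Y_less in auto)
    moreover have "(Y - real M) * (Y + 1) \<le> (Y - real M) * Y + 1" using M
      by (simp add: algebra_simps)
    ultimately show ?thesis using M by simp
  qed
  have "(\<Sum>m=1..M. real_of_int \<lfloor>f (real m)\<rfloor>) = (\<Sum>m=1..M. f (real m) - 1/2 - sawtooth (f (real m)))"
    by (intro sum.cong) (auto simp: sawtooth_def frac_def)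
  also have "\<dots> = (\<Sum>m=1..M. f (real m)) - real M / 2 - (\<Sum>m=1..M. sawtooth (f (real m)))"
    by (simp add: sum_subtractf)
  finally have fl: "(\<Sum>m=1..M. real_of_int \<lfloor>f (real m)\<rfloor>) = \<dots>" .
  define e where "e = Y - real M"
  have e: "0 \<le> e" "e \<le> 1" using M by (auto simp: e_def)
  have "e ^ 2 \<le> 1" using e by (intro power_le_one) auto
  then have e2: "\<bar>e - e ^ 2\<bar> \<le> 1" using e zero_le_power2[of e] by linarith
  define T where "T = (Y - real M) * Y"
  \<comment> \<open>All terms of order \<open>Y\<close> and \<open>Y\<^sup>2\<close> cancel.\<close>
  have id: "2 * T - Y ^ 2 + real M + real M ^ 2 - Y = - (e - e ^ 2)"
    by (simp add: T_def e_def power2_eq_square algebra_simps)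
  have "\<bar>2 * (\<Sum>m=1..M. of_int \<lfloor>f (real m)\<rfloor>) - real M ^ 2
    - (lame_integral k (1 / real k) * X ^ 2 - X)\<bar> \<le> 2 * B + 10"
  proof -
    have "\<bar>2 * (F - m / 2 - S) - m2 - (2 * I - y2 - X)\<bar> \<le> 2 * B + 10"
      if "\<bar>S\<bar> \<le> B + 1" "\<bar>F - (J - X / 2 + v / 2)\<bar> \<le> 1 / 2" "\<bar>I - J - T\<bar> \<le> 1" "Y \<le> v" "v \<le> Y + 1"
        "\<bar>d\<bar> \<le> 1" "2 * T - y2 + m + m2 - Y = - d" for F m S m2 I y2 v d :: real
      using that unfolding abs_le_iff by (intro conjI) (simp_all add: field_simps)
    from this[OF S0 trap[unfolded f0] last[folded T_def] fM e2 id] show ?thesis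
      unfolding fl area .
  qed
  also have "\<dots> \<le> 2 * B + 10 * Z" using Z1 by simp
  also have "\<dots> = (50 + 36 * 3 ^ k + 130000 * real k ^ 2) * Z" by (simp add: B_def algebra_simps)
  finally show ?thesis by (simp add: Z_def)
qed

end

section \<open>Tuples with bounded power sum\<close>

definition tuples_le :: "nat \<Rightarrow> nat \<Rightarrow> real \<Rightarrow> nat list set" where
  "tuples_le k s x = {xs. length xs = s \<and> (\<forall>y\<in>set xs. 0 < y) \<and> real (\<Sum>y\<leftarrow>xs. y ^ k) \<le> x}"

lemma power_le_iff_le_root:
  assumes "0 < k" "0 \<le> x"
  shows "real m ^ k \<le> x \<longleftrightarrow> m \<le> nat \<lfloor>x powr (1 / real k)\<rfloor>"
proof -
  have "(x powr (1 / real k)) ^ k = x"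
    using assms by (cases "x = 0") (auto simp: powr_realpow[symmetric] powr_powr)
  then have "real m ^ k \<le> x \<longleftrightarrow> real m \<le> x powr (1 / real k)"
    by (metis assms(1) of_nat_0_le_iff power_mono_iff powr_ge_zero)
  also have "\<dots> \<longleftrightarrow> m \<le> nat \<lfloor>x powr (1 / real k)\<rfloor>"
    by (meson le_nat_floor of_nat_floor of_nat_le_iff order_trans powr_ge_zero)
  finally show ?thesis .
qed

lemma tuples_le_conv_UN:
  assumes "0 < s"
  shows "tuples_le k s x = (\<Union>m\<in>{m. 0 < m \<and> real m \<le> x}. rep_tuples k s m)"
proof -
  have "0 < (\<Sum>y\<leftarrow>xs. y ^ k)" if "length xs = s" "\<forall>y\<in>set xs. 0 < y" for xs :: "nat list"
    using that assms by (cases xs) auto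
  then show ?thesis by (auto simp: tuples_le_def rep_tuples_def)
qed

lemma finite_nat_le_real: "finite {m::nat. P m \<and> real m \<le> x}"
  by (rule finite_subset[of _ "{..nat \<lfloor>x\<rfloor>}"]) (auto simp: le_nat_floor)

lemma finite_tuples_le:
  assumes "0 < k" shows "finite (tuples_le k s x)"
proof (cases "s = 0")
  case True
  then show ?thesis by (auto simp: tuples_le_def intro: finite_subset[of _ "{[]}"])
next
  case False
  then show ?thesis using assms finite_nat_le_real[of "\<lambda>m. 0 < m" x]
    by (auto simp: tuples_le_conv_UN intro: finite_rep_tuples)
qed

lemma sum_r_eq_card_tuples_le:
  assumes "0 < k" "0 < s"
  shows "(\<Sum>m | 0 < m \<and> real m \<le> x. real (r k s m)) = real (card (tuples_le k s x))"
proof -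
  have "card (tuples_le k s x) = (\<Sum>m | 0 < m \<and> real m \<le> x. card (rep_tuples k s m))"
    unfolding tuples_le_conv_UN[OF assms(2)]
  proof (intro card_UN_disjoint finite_nat_le_real ballI impI)
    show "finite (rep_tuples k s m)" for m using assms(1) by (rule finite_rep_tuples)
    show "rep_tuples k s m \<inter> rep_tuples k s n = {}" if "m \<noteq> n" for m n
      using that by (auto simp: rep_tuples_def)
  qed
  then show ?thesis by (simp add: r_def)
qed

lemma tuples_le_empty:
  assumes "0 < s" "x < 1" shows "tuples_le k s x = {}"
  using assms by (auto simp: tuples_le_conv_UN)

lemma card_tuples_le_Suc:
  assumes k: "0 < k" and x: "0 \<le> x"
  shows "card (tuples_le k (Suc s) x) = (\<Sum>m=1..nat \<lfloor>x powr (1 / real k)\<rfloor>. card (tuples_le k s (x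
    - real m ^ k)))"
proof -
  define S where "S = Sigma {1..nat \<lfloor>x powr (1 / real k)\<rfloor>} (\<lambda>m. tuples_le k s (x - real m ^ k))"
  have "tuples_le k (Suc s) x = (\<lambda>(m, xs). m # xs) ` S"
  proof (intro equalityI subsetI)
    fix zs assume zs: "zs \<in> tuples_le k (Suc s) x"
    then obtain m xs where z: "zs = m # xs" by (cases zs) (auto simp: tuples_le_def)
    have h: "0 < m" "real m ^ k + real (\<Sum>y\<leftarrow>xs. y ^ k) \<le> x" using zs by (auto simp: z tuples_le_def)
    then have "real m ^ k \<le> x" by (smt (verit) of_nat_0_le_iff)
    then have "m \<in> {1..nat \<lfloor>x powr (1 / real k)\<rfloor>}"
      using h power_le_iff_le_root[OF k x] by auto
    moreover have "xs \<in> tuples_le k s (x - real m ^ k)" using zs h by (auto simp: z tuples_le_def)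
    ultimately show "zs \<in> (\<lambda>(m, xs). m # xs) ` S" by (auto simp: S_def z)
  next
    fix zs assume "zs \<in> (\<lambda>(m, xs). m # xs) ` S"
    then show "zs \<in> tuples_le k (Suc s) x" by (auto simp: S_def tuples_le_def)
  qed
  then have "card (tuples_le k (Suc s) x) = card S"
    by (simp add: card_image inj_on_def split_def prod_eq_iff)
  then show ?thesis using finite_tuples_le[OF k] by (simp add: S_def)
qed

text \<open>
  A pair with power sum at most \<open>X ^ k\<close> has a coordinate with power at most \<open>X ^ k / 2\<close>, that is,
  a coordinate at most \<open>M\<close>. Inclusion and exclusion over the two coordinates counts the pairs
  with both coordinates at most \<open>M\<close> twice, and all \<open>M\<^sup>2\<close> of these pairs are admissible.
\<close>
lemma card_tuples_le_2:
  assumes k: "2 \<le> k" and X: "1 \<le> X"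
  shows "real (card (tuples_le k 2 (X ^ k))) =
     2 * (\<Sum>m=1..lame_curve.M k X. of_int \<lfloor>lame_curve.f k X (real m)\<rfloor>) - real (lame_curve.M k X) ^ 2"
proof -
  interpret lame_curve k X using assms by unfold_locales
  define L1 where "L1 = Sigma {1..M} (\<lambda>m. {1..nat \<lfloor>f (real m)\<rfloor>})"
  have fiff: "real m ^ k + real n ^ k \<le> X ^ k \<longleftrightarrow> n \<le> nat \<lfloor>f (real m)\<rfloor>" if "real m \<le> X" for m n
    using power_le_iff_le_root[of k "X ^ k - real m ^ k" n] that k
      by (simp add: f_def power_mono algebra_simps)
  have Miff: "2 * real m ^ k \<le> X ^ k \<longleftrightarrow> m \<le> M" for m
  proof -
    have "(X ^ k / 2) powr (1 / real k) = Y"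
      unfolding Y_power[symmetric] using Y_pos k by (simp add: powr_realpow[symmetric] powr_powr)
    then show ?thesis using power_le_iff_le_root[of k "X ^ k / 2" m] k X_pos
      by (simp add: M_def mult.commute)
  qed
  have MX: "real m \<le> X" if "m \<le> M" for m using that M_le Y_less by linarith
  define T where "T = (\<lambda>(m, n). [m, n]) ` L1"
  define T' where "T' = (\<lambda>(m, n). [n, m]) ` L1"
  have memT: "[m, n] \<in> T \<longleftrightarrow> 1 \<le> m \<and> m \<le> M \<and> 1 \<le> n \<and> real m ^ k + real n ^ k \<le> X ^ k" for m n
    using fiff MX by (auto simp: T_def L1_def)
  have memT': "[m, n] \<in> T' \<longleftrightarrow> 1 \<le> n \<and> n \<le> M \<and> 1 \<le> m \<and> real m ^ k + real n ^ k \<le> X ^ k" for m n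
    using fiff[of n m] MX[of n] by (auto simp: T'_def L1_def add.commute)
  have two: "(\<exists>m n. xs = [m, n]) \<longleftrightarrow> length xs = 2" for xs :: "nat list"
    by (auto simp: length_Suc_conv numeral_2_eq_2)
  have "tuples_le k 2 (X ^ k) = T \<union> T'"
  proof (rule set_eqI)
    fix xs :: "nat list"
    show "xs \<in> tuples_le k 2 (X ^ k) \<longleftrightarrow> xs \<in> T \<union> T'"
    proof (cases "length xs = 2")
      case True
      then obtain m n where xs: "xs = [m, n]" using two by blast
      have "m \<le> M \<or> n \<le> M" if "real m ^ k + real n ^ k \<le> X ^ k"
        using that Miff[of m] Miff[of n] by linarith
      then show ?thesis using memT memT' by (auto simp: xs tuples_le_def)
    next
      case False
      then show ?thesis by (auto simp: tuples_le_def T_def T'_def)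
    qed
  qed
  moreover have "T \<inter> T' = (\<lambda>(m, n). [m, n]) ` ({1..M} \<times> {1..M})"
  proof (rule set_eqI)
    fix xs :: "nat list"
    show "xs \<in> T \<inter> T' \<longleftrightarrow> xs \<in> (\<lambda>(m, n). [m, n]) ` ({1..M} \<times> {1..M})"
    proof (cases "length xs = 2")
      case True
      then obtain m n where xs: "xs = [m, n]" using two by blast
      have "real m ^ k + real n ^ k \<le> X ^ k" if "m \<le> M" "n \<le> M"
        using that Miff[of m] Miff[of n] by linarith
      then show ?thesis using memT memT' by (auto simp: xs)
    next
      case False
      then show ?thesis by (auto simp: T_def T'_def)
    qed
  qed
  then have cardI: "card (T \<inter> T') = M ^ 2"
    by (simp add: card_image inj_on_def split_def prod_eq_iff card_cartesian_product
      power2_eq_square)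
  have finL: "finite L1" by (simp add: L1_def)
  have cT: "card T = card L1" "card T' = card L1"
    by (auto simp: T_def T'_def card_image inj_on_def split_def prod_eq_iff)
  have fin: "finite T" "finite T'" using finL by (auto simp: T_def T'_def)
  have "card T + card T' = card (T \<union> T') + card (T \<inter> T')" by (rule card_Un_Int[OF fin])
  ultimately have "2 * card L1 = card (tuples_le k 2 (X ^ k)) + M ^ 2" by (simp add: cT cardI)
  moreover have "real (card L1) = (\<Sum>m=1..M. of_int \<lfloor>f (real m)\<rfloor>)"
  proof -
    have "card L1 = (\<Sum>m=1..M. nat \<lfloor>f (real m)\<rfloor>)" by (simp add: L1_def)
    moreover have "real (nat \<lfloor>f (real m)\<rfloor>) = of_int \<lfloor>f (real m)\<rfloor>" for m by (simp add: f_def)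
    ultimately show ?thesis by simp
  qed
  moreover have "real (2 * card L1) = real (card (tuples_le k 2 (X ^ k)) + M ^ 2)"
    using calculation(1) by (rule arg_cong)
  ultimately show ?thesis by simp
qed

section \<open>Adding one coordinate at a time\<close>

text \<open>
  Dirichlet's formula for the volume of the set of all \<open>t\<close> in the positive orthant of the
  \<open>s\<close>-dimensional space whose coordinates satisfy \<open>(\<Sum>i<s. t i ^ k) \<le> 1\<close>.
\<close>
definition orthant_volume :: "nat \<Rightarrow> nat \<Rightarrow> real" where
  "orthant_volume k s = Gamma (1 + 1 / real k) ^ s / Gamma (1 + real s / real k)"

lemma orthant_volume_pos: "0 < orthant_volume k s"
  unfolding orthant_volume_def by (intro divide_pos_pos zero_less_power Gamma_real_pos
    add_pos_nonneg) auto

text \<open>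
  Slicing the \<open>(s + 1)\<close>-dimensional body at height \<open>t\<close> leaves the \<open>s\<close>-dimensional one
  scaled to volume \<open>(1 - t ^ k) powr (s/k)\<close>.
\<close>
lemma orthant_volume_Suc:
  assumes "0 < k" "0 < s" shows "orthant_volume k (Suc s) = orthant_volume k s
    * lame_integral k (real s / real k)"
proof -
  have "Gamma (1 + real s / real k) > 0" by (intro Gamma_real_pos add_pos_nonneg) auto
  then show ?thesis using assms
    by (simp add: orthant_volume_def lame_integral_eq_Gamma add_divide_distrib add_ac)
qed

definition main_terms :: "nat \<Rightarrow> nat \<Rightarrow> real \<Rightarrow> real" where
  "main_terms k s x = orthant_volume k s * x powr (real s / real k) - real s / 2
    * orthant_volume k (s - 1) * x powr (real (s - 1) / real k)"

text \<open>
  In the induction step the arguments \<open>x - m ^ k\<close> come arbitrarily close to 0, where no tuples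
  exist. The main terms are then within the error bound because, for \<open>x < 1\<close>, smaller exponents
  give larger powers.
\<close>
lemma main_terms_bound_below_1:
  assumes "2 \<le> k" "2 \<le> s" "0 \<le> x" "x < 1"
  shows "\<bar>main_terms k s x\<bar> \<le> (orthant_volume k s + real s / 2 * orthant_volume k (s - 1))
    * x powr (real (s - 1) / real k - 1 / real k ^ 2)"
proof -
  define e where "e = real (s - 1) / real k - 1 / real k ^ 2"
  have le: "x powr (real s / real k) \<le> x powr e" "x powr (real (s - 1) / real k) \<le> x powr e"
  proof -
    have e: "e \<le> real (s - 1) / real k" by (simp add: e_def)
    have "real (s - 1) / real k \<le> real s / real k" by (intro divide_right_mono) auto
    with e have "e \<le> real s / real k" by simp
    with e show "x powr (real s / real k) \<le> x powr e" "x powr (real (s - 1) / real k) \<le> x powr e"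
      using assms by (auto intro!: powr_mono')
  qed
  have "\<bar>main_terms k s x\<bar> \<le> orthant_volume k s * x powr (real s / real k) + real s / 2
    * orthant_volume k (s - 1) * x powr (real (s - 1) / real k)"
    unfolding main_terms_def using orthant_volume_pos[of k s] orthant_volume_pos[of k "s - 1"]
    by (intro order_trans[OF abs_triangle_ineq4]) (simp add: abs_mult)
  also have "\<dots> \<le> orthant_volume k s * x powr e + real s / 2 * orthant_volume k (s - 1) * x powr e"
    using le orthant_volume_pos[of k s] orthant_volume_pos[of k "s - 1"]
      by (intro add_mono mult_left_mono) auto
  finally show ?thesis by (simp add: e_def algebra_simps)
qed

lemma card_tuples_le_2_asymptotic:
  assumes k: "4 \<le> k"
  shows "\<exists>C. \<forall>x\<ge>1. \<bar>real (card (tuples_le k 2 x)) - main_terms k 2 x\<bar> \<le> C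
    * x powr (1 / real k - 1 / real k ^ 2)"
proof (intro exI allI impI)
  fix x :: real assume x: "1 \<le> x"
  define X where "X = x powr (1 / real k)"
  have X: "1 \<le> X" unfolding X_def using x by (intro ge_one_powr_ge_zero) auto
  have Xk: "X ^ k = x" using x k by (simp add: X_def powr_realpow[symmetric] powr_powr)
  interpret lame_curve k X using k X by unfold_locales auto
  have v1: "orthant_volume k 1 = 1"
  proof -
    have "0 < Gamma (1 + 1 / real k)" by (intro Gamma_real_pos add_pos_nonneg) auto
    then show ?thesis by (simp add: orthant_volume_def)
  qed
  have v2: "orthant_volume k 2 = lame_integral k (1 / real k)"
    using orthant_volume_Suc[of k 1] k v1 by (simp add: numeral_2_eq_2)
  have X2: "X ^ 2 = x powr (2 / real k)"
  proof -
    have "X ^ 2 = X powr 2" using X by simp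
    also have "\<dots> = x powr (1 / real k * 2)" unfolding X_def powr_powr by (rule refl)
    finally show ?thesis by simp
  qed
  have "main_terms k 2 x = lame_integral k (1 / real k) * X ^ 2 - X"
    by (simp add: main_terms_def v1[unfolded One_nat_def] v2 X2) (simp add: X_def)
  moreover have "X powr (1 - 1 / real k) = x powr (1 / real k - 1 / real k ^ 2)"
    by (simp add: X_def powr_powr algebra_simps power2_eq_square)
  ultimately show "\<bar>real (card (tuples_le k 2 x)) - main_terms k 2 x\<bar>
    \<le> (50 + 36 * 3 ^ k + 130000 * real k ^ 2) * x powr (1 / real k - 1 / real k ^ 2)"
    using sum_floor_f[OF k] card_tuples_le_2[OF k2 X] by (simp add: Xk)
qed

text \<open>
  The leading term for \<open>s\<close> reproduces the leading term for \<open>s + 1\<close> and, from the endpoint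
  of the trapezoid rule, \<open>-1/2\<close> times \<open>orthant_volume k s * x powr (s/k)\<close>; the second term for \<open>s\<close>
  contributes \<open>-s/2\<close> times the same quantity. The inherited error exponent \<open>e\<close> is nonnegative since
  \<open>s \<ge> 2\<close>, so each summand has error at most \<open>C * x powr e\<close>.
\<close>
lemma card_tuples_le_asymptotic_step:
  assumes k: "2 \<le> k" and s: "2 \<le> s" "s \<le> k"
    and IH: "\<And>y. 0 \<le> y \<Longrightarrow> \<bar>real (card (tuples_le k s y)) - main_terms k s y\<bar> \<le> C
      * y powr (real (s - 1) / real k - 1 / real k ^ 2)"
    and x: "1 \<le> x" and C: "0 \<le> C"
  shows "\<bar>real (card (tuples_le k (Suc s) x)) - main_terms k (Suc s) x\<bar>
     \<le> (C + orthant_volume k s * (4 * real k) + real s / 2 * orthant_volume k (s - 1)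
       * (4 * real k + 1)) * x powr (real s / real k - 1 / real k ^ 2)"
proof -
  define X where "X = x powr (1 / real k)"
  define e where "e = real (s - 1) / real k - 1 / real k ^ 2"
  define e' where "e' = real s / real k - 1 / real k ^ 2"
  define N where "N = nat \<lfloor>X\<rfloor>"
  have X: "1 \<le> X" unfolding X_def using x by (intro ge_one_powr_ge_zero) auto
  have N: "real N \<le> X" using X by (simp add: N_def)
  have ee: "e' = 1 / real k + e" using s by (simp add: e_def e'_def of_nat_diff field_simps)
  have e0: "0 \<le> e"
  proof -
    have "1 / real k ^ 2 \<le> 1 / real k" using k
      by (intro divide_left_mono) (auto simp: power2_eq_square)
    also have "\<dots> \<le> real (s - 1) / real k" using s by (intro divide_right_mono) auto
    finally show ?thesis by (simp add: e_def)
  qed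
  have mx: "real m ^ k \<le> x" if "m \<le> N" for m
    using that power_le_iff_le_root[of k x m] k x by (simp add: N_def X_def)
  have cnt: "real (card (tuples_le k (Suc s) x))
    = (\<Sum>m=1..N. real (card (tuples_le k s (x - real m ^ k))))"
    using card_tuples_le_Suc[of k x s] k x by (simp add: N_def X_def)
  define S1 where "S1 = (\<Sum>m=1..N. (x - real m ^ k) powr (real s / real k))"
  define S2 where "S2 = (\<Sum>m=1..N. (x - real m ^ k) powr (real (s - 1) / real k))"
  have main: "(\<Sum>m=1..N. main_terms k s (x - real m ^ k)) = orthant_volume k s * S1 - real s / 2
    * orthant_volume k (s - 1) * S2"
    unfolding main_terms_def S1_def S2_def by (simp only: sum_subtractf sum_distrib_left)
  have err: "\<bar>real (card (tuples_le k (Suc s) x)) - (\<Sum>m=1..N. main_terms k s (x - real m ^ k))\<bar>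
    \<le> C * x powr e'"
  proof -
    have "\<bar>real (card (tuples_le k (Suc s) x)) - (\<Sum>m=1..N. main_terms k s (x - real m ^ k))\<bar>
      \<le> (\<Sum>m=1..N. \<bar>real (card (tuples_le k s (x - real m ^ k))) - main_terms k s (x - real m ^ k)\<bar>)"
      unfolding cnt sum_subtractf[symmetric] by (rule sum_abs)
    also have "\<dots> \<le> (\<Sum>m=1..N. C * x powr e)"
    proof (rule sum_mono)
      fix m assume m: "m \<in> {1..N}"
      have "\<bar>real (card (tuples_le k s (x - real m ^ k))) - main_terms k s (x - real m ^ k)\<bar> \<le> C
        * (x - real m ^ k) powr e"
        unfolding e_def using mx[of m] m by (intro IH) auto
      also have "\<dots> \<le> C * x powr e"
        using C e0 mx[of m] m by (intro mult_left_mono powr_mono2) auto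
      finally show "\<bar>real (card (tuples_le k s (x - real m ^ k)))
        - main_terms k s (x - real m ^ k)\<bar> \<le> C * x powr e" .
    qed
    also have "\<dots> = real N * (C * x powr e)" by simp
    also have "\<dots> \<le> X * (C * x powr e)" using N C by (intro mult_right_mono) auto
    also have "\<dots> = C * x powr e'" by (simp add: X_def ee powr_add)
    finally show ?thesis .
  qed
  have S1: "\<bar>S1 - (lame_integral k (real s / real k) * x powr (real (Suc s) / real k)
    - x powr (real s / real k) / 2)\<bar> \<le> 4 * real k * x powr e'"
  proof -
    have "\<bar>S1 - (lame_integral k (real s / real k) * x powr (real s / real k + 1 / real k)
      - x powr (real s / real k) / 2)\<bar> \<le> 4 * real k
      * x powr (real s / real k - real s / real k / real k)"
      unfolding S1_def N_def X_def using k s x by (intro sum_lame_powr) auto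
    also have "\<dots> \<le> 4 * real k * x powr e'"
    proof (intro mult_left_mono powr_mono)
      have "1 / real k ^ 2 \<le> real s / real k ^ 2" using s by (intro divide_right_mono) auto
      then show "real s / real k - real s / real k / real k \<le> e'"
        by (simp add: e'_def power2_eq_square)
    qed (use x in auto)
    finally show ?thesis by (simp add: add_divide_distrib add.commute)
  qed
  have S2: "\<bar>S2 - lame_integral k (real (s - 1) / real k) * x powr (real s / real k)\<bar>
    \<le> (4 * real k + 1) * x powr e'"
  proof -
    define p where "p = real (s - 1) / real k"
    have p: "0 < p" "p \<le> 1" "p + 1 / real k = real s / real k" using k s
      by (auto simp: p_def of_nat_diff field_simps)
    have "\<bar>S2 - (lame_integral k p * x powr (p + 1 / real k) - x powr p / 2)\<bar> \<le> 4 * real k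
      * x powr (p - p / real k)"
      unfolding S2_def N_def X_def p_def[symmetric] using k p x by (intro sum_lame_powr) auto
    moreover have pe: "p \<le> e'"
    proof -
      have "1 / real k ^ 2 \<le> 1 / real k" using k
        by (intro divide_left_mono) (auto simp: power2_eq_square)
      then show ?thesis using p(3) by (simp add: e'_def)
    qed
    have "x powr p \<le> x powr e'" using x pe by (intro powr_mono) auto
    moreover have "0 \<le> p / real k" using p by simp
    then have "x powr (p - p / real k) \<le> x powr e'" using x pe by (intro powr_mono) linarith+
    then have "4 * real k * x powr (p - p / real k) \<le> 4 * real k * x powr e'"
      by (intro mult_left_mono) auto
    moreover have "0 \<le> x powr p" by simp
    ultimately have "\<bar>S2 - lame_integral k p * x powr (p + 1 / real k)\<bar> \<le> 4 * real k * x powr e'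
      + x powr e'"
      by linarith
    then show ?thesis unfolding p(3) p_def[symmetric] by (simp add: algebra_simps)
  qed
  have vs: "orthant_volume k (Suc s) = orthant_volume k s * lame_integral k (real s / real k)"
    using k s by (intro orthant_volume_Suc) auto
  have vs': "orthant_volume k s = orthant_volume k (s - 1)
    * lame_integral k (real (s - 1) / real k)" using k s orthant_volume_Suc[of k "s - 1"] by simp
  have "main_terms k (Suc s) x =
     orthant_volume k s * (lame_integral k (real s / real k) * x powr (real (Suc s) / real k)
       - x powr (real s / real k) / 2)
     - real s / 2 * orthant_volume k (s - 1) *
       (lame_integral k (real (s - 1) / real k) * x powr (real s / real k))"
  proof -
    have "real s / 2 * orthant_volume k (s - 1)
      * (lame_integral k (real (s - 1) / real k) * x powr (real s / real k)) = real s / 2 *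
      orthant_volume k s * x powr (real s / real k)"
      using vs' by simp
    then show ?thesis unfolding main_terms_def vs by (simp add: algebra_simps)
  qed
  then have "real (card (tuples_le k (Suc s) x)) - main_terms k (Suc s) x =
     (real (card (tuples_le k (Suc s) x)) - (\<Sum>m=1..N. main_terms k s (x - real m ^ k)))
     + orthant_volume k s * (S1 - (lame_integral k (real s / real k)
       * x powr (real (Suc s) / real k) - x powr (real s / real k) / 2))
     - real s / 2 * orthant_volume k (s - 1) *
       (S2 - lame_integral k (real (s - 1) / real k) * x powr (real s / real k))"
    unfolding main by (simp only: right_diff_distrib)
  also have "\<bar>\<dots>\<bar> \<le> C * x powr e' + orthant_volume k s * (4 * real k * x powr e') + real s / 2
    * orthant_volume k (s - 1) * ((4 * real k + 1) * x powr e')"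
  proof -
    have tri: "\<bar>a + b - c\<bar> \<le> A + B + D" if "\<bar>a\<bar> \<le> A" "\<bar>b\<bar> \<le> B" "\<bar>c\<bar> \<le> D" for a b c A B D :: real
      using that by linarith
    have scale: "\<bar>v * u\<bar> \<le> v * b" if "\<bar>u\<bar> \<le> b" "0 \<le> v" for u v b :: real
      using that by (simp add: abs_mult mult_left_mono)
    show ?thesis
      using orthant_volume_pos[of k s] orthant_volume_pos[of k "s - 1"]
      by (intro tri err scale[OF S1] scale[OF S2]) auto
  qed
  finally show ?thesis by (simp add: e'_def algebra_simps add_divide_distrib)
qed

lemma card_tuples_le_asymptotic:
  assumes k: "4 \<le> k" and s: "2 \<le> s" "s \<le> k + 1"
  shows "\<exists>C\<ge>0. \<forall>x\<ge>0. \<bar>real (card (tuples_le k s x)) - main_terms k s x\<bar> \<le> C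
    * x powr (real (s - 1) / real k - 1 / real k ^ 2)"
proof -
  have extend: "\<exists>C\<ge>0. \<forall>x\<ge>0. \<bar>real (card (tuples_le k s x)) - main_terms k s x\<bar> \<le> C
    * x powr (real (s - 1) / real k - 1 / real k ^ 2)"
    if "2 \<le> s" and C: "\<And>x. 1 \<le> x \<Longrightarrow> \<bar>real (card (tuples_le k s x)) - main_terms k s x\<bar> \<le> C
      * x powr (real (s - 1) / real k - 1 / real k ^ 2)"
    for s C
  proof (intro exI[of _ "\<bar>C\<bar> + (orthant_volume k s + real s / 2
    * orthant_volume k (s - 1))"] conjI allI impI)
    define D where "D = orthant_volume k s + real s / 2 * orthant_volume k (s - 1)"
    define e where "e = real (s - 1) / real k - 1 / real k ^ 2"
    have D: "0 \<le> D" unfolding D_def using orthant_volume_pos[of k s]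
      orthant_volume_pos[of k "s - 1"] by (intro add_nonneg_nonneg mult_nonneg_nonneg) auto
    then show "0 \<le> \<bar>C\<bar> + (orthant_volume k s + real s / 2 * orthant_volume k (s - 1))"
      by (simp add: D_def)
    fix x :: real assume x: "0 \<le> x"
    have "\<bar>real (card (tuples_le k s x)) - main_terms k s x\<bar> \<le> (\<bar>C\<bar> + D) * x powr e"
    proof (cases "1 \<le> x")
      case True
      have "C * x powr e \<le> (\<bar>C\<bar> + D) * x powr e" using D by (intro mult_right_mono) auto
      then show ?thesis using C[OF True] by (simp add: e_def)
    next
      case False
      have "D * x powr e \<le> (\<bar>C\<bar> + D) * x powr e" by (intro mult_right_mono) auto
      then show ?thesis using main_terms_bound_below_1[of k s x] False x k \<open>2 \<le> s\<close>
        by (simp add: tuples_le_empty e_def D_def)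
    qed
    then show "\<bar>real (card (tuples_le k s x)) - main_terms k s x\<bar>
      \<le> (\<bar>C\<bar> + (orthant_volume k s + real s / 2 * orthant_volume k (s - 1))) * x powr
      (real (s - 1) / real k - 1 / real k ^ 2)"
      by (simp add: D_def e_def)
  qed
  from s show ?thesis
  proof (induction s rule: dec_induct)
    case base
    then show ?case using card_tuples_le_2_asymptotic[OF k] extend[of 2] by auto
  next
    case (step s)
    then obtain C where C: "0 \<le> C" "\<And>x. 0 \<le> x
      \<Longrightarrow> \<bar>real (card (tuples_le k s x)) - main_terms k s x\<bar> \<le> C * x powr
      (real (s - 1) / real k - 1 / real k ^ 2)"
      by auto
    show ?case
      using card_tuples_le_asymptotic_step[of k s C] C step k by (intro extend) auto
  qed
qed

theorem theorem1p1:
  fixes k s :: nat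
  assumes "4 \<le> k" and "2 \<le> s" and "s \<le> k + 1"
  shows "(\<exists>C::real. \<forall>n::nat. 0 < n \<longrightarrow>
            \<bar>(\<Sum>m = 1..n. real (r k s m))
              - (Gamma ((real k + 1) / real k) ^ s / Gamma ((real k + real s) / real k)
                    * real n powr (real s / real k)
                 - real s / 2
                    * (Gamma ((real k + 1) / real k) ^ (s - 1)
                        / Gamma ((real k + real s - 1) / real k))
                    * real n powr ((real s - 1) / real k))\<bar>
            \<le> C * real n powr (((real s - 1) * real k - 1) / (real k)\<^sup>2))
       \<and> (\<exists>C::real. \<forall>x::real. 1 < x \<longrightarrow>
            \<bar>(\<Sum>m | 0 < m \<and> real m \<le> x. real (r k s m))
              - (Gamma ((real k + 1) / real k) ^ s / Gamma ((real k + real s) / real k)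
                    * x powr (real s / real k)
                 - real s / 2
                    * (Gamma ((real k + 1) / real k) ^ (s - 1)
                        / Gamma ((real k + real s - 1) / real k))
                    * x powr ((real s - 1) / real k))\<bar>
            \<le> C * x powr (((real s - 1) * real k - 1) / (real k)\<^sup>2))"
proof -
  have gam: "(real k + 1) / real k = 1 + 1 / real k"
    "(real k + real s) / real k = 1 + real s / real k"
      "(real k + real s - 1) / real k = 1 + real (s - 1) / real k"
      "(real s - 1) / real k = real (s - 1) / real k"
    using assms by (auto simp: of_nat_diff add_divide_distrib diff_divide_distrib)
  have ex: "((real s - 1) * real k - 1) / (real k)\<^sup>2 = real (s - 1) / real k - 1 / real k ^ 2"
    using assms by (simp add: of_nat_diff field_simps power2_eq_square)
  obtain C where C: "\<And>x. 0 \<le> x \<Longrightarrow> \<bar>real (card (tuples_le k s x)) - main_terms k s x\<bar> \<le> C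
    * x powr (real (s - 1) / real k - 1 / real k ^ 2)"
    using card_tuples_le_asymptotic[OF assms] by blast
  have set: "{1..n} = {m. 0 < m \<and> real m \<le> real n}" for n by auto
  have sum: "(\<Sum>m | 0 < m \<and> real m \<le> x. real (r k s m)) = real (card (tuples_le k s x))" for x
    using assms by (intro sum_r_eq_card_tuples_le) auto
  show ?thesis
    unfolding gam ex set sum
    using C unfolding main_terms_def orthant_volume_def by (intro conjI exI[of _ C]) auto
qed

end
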